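(* Let $\lambda$ be an infinite cardinal and let $\alpha<\lambda^+$ be a limit ordinal. If $G$ is a $(\lambda,\alpha)$-limit model in the class of abelian groups with the subgroup relation, then \[ G \cong \Big(\bigoplus_{\lambda}\mathbb{Q}\Big) \oplus \bigoplus_{p \text{ prime}} \Big(\bigoplus_{\lambda} \mathbb{Z}(p^\infty)\Big).\]
   Context: Consider the class of all abelian groups ordered by the subgroup relation $\leq$. An embedding $f:H\to G$ of abelian groups is an injective homomorphism. For an infinite cardinal $\lambda$ and abelian groups $H\le G$ with $|G|=|H|=\lambda$, $G$ is universal over $H$ if for every abelian group $H^*$ of cardinality $\lambda$ with $H\le H^*$ there is an injective homomorphism $f:H^*\to G$ that is the identity on $H$. For a limit ordinal $\alpha<\lambda^+$, an abelian group $G$ is a $(\lambda,\alpha)$-limit model if there is an increasing continuous chain $\langle G_i:i<\alpha\rangle$ of abelian groups of cardinality $\lambda$ (so $G_i\le G_j$ for $i<j$, and $G_i=\bigcup_{j<i}G_j$ for limit $i$) such that $G_{i+1}$ is universal over $G_i$ for every $i$ and $G=\bigcup_{i<\alpha}G_i$. $\mathbb{Z}(p^\infty)$ denotes the Prüfer $p$-group and $\bigoplus_\lambda$ denotes a direct sum of $\lambda$ copies. *)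

theory Defs
  imports "HOL-Algebra.Algebra" "HOL-Computational_Algebra.Primes" Complex_Main
begin

unbundle cardinal_syntax

text \<open>Cardinals and ordinals are well-order relations (\<^term>\<open>Card_order\<close>, \<^term>\<open>Well_order\<close>):
  the elements of an ordinal \<^term>\<open>\<alpha>\<close> are the members of \<^term>\<open>Field \<alpha>\<close>, and
  \<^term>\<open>cardSuc \<kappa>\<close> is the successor cardinal.\<close>

definition ab_subgroup :: "'a monoid \<Rightarrow> 'a monoid \<Rightarrow> bool" where
  "ab_subgroup H G \<longleftrightarrow>
     comm_group H \<and> comm_group G \<and> subgroup (carrier H) G \<and>
     (\<forall>x\<in>carrier H. \<forall>y\<in>carrier H. x \<otimes>\<^bsub>H\<^esub> y = x \<otimes>\<^bsub>G\<^esub> y)"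

text \<open>The groups \<open>H*\<close> extending \<open>H\<close> should range over all abelian groups of cardinality
  \<open>\<kappa>\<close>.  Literal supersets of \<open>H\<close> inside the type \<^typ>\<open>'a\<close> need not provide them (the
  complement of \<open>H\<close> in \<^typ>\<open>'a\<close> may be too small), so the extension is given by an
  embedding \<open>e\<close> of \<open>H\<close> into \<open>H*\<close>, and ``identity on \<open>H\<close>'' reads \<open>f (e x) = x\<close>.
  The lemmas \<open>universal_over_any_type\<close> and \<open>universal_over_iff_inclusion\<close> below show that
  the choice of the type is immaterial and that one recovers the definition by inclusions
  as soon as the type has more than \<open>\<kappa>\<close> elements.\<close>

definition universal_over :: "'k rel \<Rightarrow> 'a monoid \<Rightarrow> 'a monoid \<Rightarrow> bool" where
  "universal_over \<kappa> H G \<longleftrightarrow>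
     ab_subgroup H G \<and> |carrier H| =o \<kappa> \<and> |carrier G| =o \<kappa> \<and>
     (\<forall>(Hs :: 'a monoid) e. comm_group Hs \<and> |carrier Hs| =o \<kappa> \<and> e \<in> mon H Hs \<longrightarrow>
        (\<exists>f\<in>mon Hs G. \<forall>x\<in>carrier H. f (e x) = x))"

text \<open>In the library \<^term>\<open>wo_rel.isLim \<alpha> i\<close> means that \<open>i\<close> is not a successor, so it
  includes the least element, for which continuity is not required.\<close>

definition limit_model :: "'k rel \<Rightarrow> 'o rel \<Rightarrow> 'a monoid \<Rightarrow> bool" where
  "limit_model \<kappa> \<alpha> G \<longleftrightarrow>
     (\<exists>C :: 'o \<Rightarrow> 'a monoid.
        (\<forall>i\<in>Field \<alpha>. comm_group (C i) \<and> |carrier (C i)| =o \<kappa>) \<and>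
        (\<forall>j\<in>Field \<alpha>. \<forall>i\<in>underS \<alpha> j. ab_subgroup (C i) (C j)) \<and>
        (\<forall>i\<in>Field \<alpha>. i \<noteq> wo_rel.zero \<alpha> \<and> wo_rel.isLim \<alpha> i \<longrightarrow>
           carrier (C i) = (\<Union>j\<in>underS \<alpha> i. carrier (C j))) \<and>
        (\<forall>i\<in>Field \<alpha>. universal_over \<kappa> (C i) (C (wo_rel.succ \<alpha> i))) \<and>
        (\<forall>i\<in>Field \<alpha>. ab_subgroup (C i) G) \<and>
        carrier G = (\<Union>i\<in>Field \<alpha>. carrier (C i)))"

definition rat_group :: "rat monoid" where
  "rat_group = \<lparr>carrier = UNIV, monoid.mult = (+), one = 0\<rparr>"

text \<open>The complex roots of unity of \<open>p\<close>-power order.\<close>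

definition prufer_group :: "nat \<Rightarrow> complex monoid" where
  "prufer_group p = \<lparr>carrier = {z. \<exists>n. z ^ (p ^ n) = 1}, monoid.mult = (*), one = 1\<rparr>"

lemma comm_group_transport:
  fixes K :: "'b monoid" and b :: "'b \<Rightarrow> 'a"
  assumes K: "comm_group K" and b: "inj_on b (carrier K)"
  defines "d \<equiv> inv_into (carrier K) b"
  defines "L \<equiv> \<lparr>carrier = b ` carrier K, monoid.mult = (\<lambda>x y. b (d x \<otimes>\<^bsub>K\<^esub> d y)), one = b \<one>\<^bsub>K\<^esub>\<rparr>"
  shows "comm_group L" and "b \<in> iso K L"
proof -
  interpret K: comm_group K by (rule K)
  have d: "d (b x) = x" if "x \<in> carrier K" for x
    using that b by (simp add: d_def)
  show L: "comm_group L"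
  proof (rule comm_groupI)
    fix x assume "x \<in> carrier L"
    then obtain u where u: "u \<in> carrier K" "x = b u" by (auto simp: L_def)
    show "\<exists>y\<in>carrier L. y \<otimes>\<^bsub>L\<^esub> x = \<one>\<^bsub>L\<^esub>"
      by (rule bexI[of _ "b (inv\<^bsub>K\<^esub> u)"]) (use u in \<open>auto simp: L_def d\<close>)
  qed (auto simp: L_def d K.m_ac)
  show "b \<in> iso K L"
    using b by (auto simp: iso_def hom_def bij_betw_def L_def d)
qed

lemma mon_group_image:
  assumes "b \<in> iso K L" "f \<in> mon L G"
  shows "f \<circ> b \<in> mon K G"
  using assms mon_compose by (metis iso_iff_mon_epi)

lemma universal_over_any_type:
  fixes Hs :: "'b monoid" and H G :: "'a monoid"
  assumes U: "universal_over \<kappa> H G" and Hs: "comm_group Hs" "|carrier Hs| =o \<kappa>"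
    and e: "e \<in> mon H Hs"
  shows "\<exists>f\<in>mon Hs G. \<forall>x\<in>carrier H. f (e x) = x"
proof -
  have "|carrier Hs| =o |carrier H|"
    using U Hs(2) unfolding universal_over_def by (meson ordIso_symmetric ordIso_transitive)
  then obtain b where b: "bij_betw b (carrier Hs) (carrier H)"
    using card_of_ordIso by blast
  then have inj: "inj_on b (carrier Hs)" by (simp add: bij_betw_def)
  obtain L :: "'a monoid" where L: "comm_group L" "b \<in> iso Hs L"
    using comm_group_transport[OF Hs(1) inj] by blast
  have "|carrier Hs| =o |carrier L|"
    using L(2) card_of_ordIso by (auto simp: iso_def)
  then have "|carrier L| =o \<kappa>" using Hs(2) by (meson ordIso_symmetric ordIso_transitive)
  moreover have "b \<circ> e \<in> mon H L"
    using e L(2) mon_compose by (metis iso_iff_mon_epi)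
  ultimately obtain f where f: "f \<in> mon L G" "\<forall>x\<in>carrier H. f ((b \<circ> e) x) = x"
    using U L(1) unfolding universal_over_def by blast
  show ?thesis
    using mon_group_image[OF L(2) f(1)] f(2) by (intro bexI[of _ "f \<circ> b"]) auto
qed

lemma universal_over_iff_inclusion:
  fixes H G :: "'a monoid"
  assumes inf: "Cinfinite \<kappa>" and big: "\<kappa> <o |UNIV :: 'a set|"
  shows "universal_over \<kappa> H G \<longleftrightarrow>
     ab_subgroup H G \<and> |carrier H| =o \<kappa> \<and> |carrier G| =o \<kappa> \<and>
     (\<forall>Hs :: 'a monoid. ab_subgroup H Hs \<and> |carrier Hs| =o \<kappa> \<longrightarrow>
        (\<exists>f\<in>mon Hs G. \<forall>x\<in>carrier H. f x = x))" (is "_ \<longleftrightarrow> ?R")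
proof
  assume U: "universal_over \<kappa> H G"
  have "\<exists>f\<in>mon Hs G. \<forall>x\<in>carrier H. f x = x"
    if Hs: "ab_subgroup H Hs" "|carrier Hs| =o \<kappa>" for Hs :: "'a monoid"
  proof -
    have "id \<in> mon H Hs"
      using Hs(1) by (auto simp: ab_subgroup_def mon_def hom_def dest: subgroup.mem_carrier)
    then show ?thesis
      using U Hs unfolding universal_over_def ab_subgroup_def by fastforce
  qed
  with U show ?R unfolding universal_over_def by blast
next
  assume R: ?R
  have "\<exists>f\<in>mon Hs G. \<forall>x\<in>carrier H. f (e x) = x"
    if Hs: "comm_group Hs" "|carrier Hs| =o \<kappa>" and e: "e \<in> mon H Hs" for Hs :: "'a monoid" and e
  proof -
    have H: "comm_group H" and cH: "|carrier H| =o \<kappa>" using R by (auto simp: ab_subgroup_def)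
    have eH: "inj_on e (carrier H)" "e ` carrier H \<subseteq> carrier Hs"
      and ehom: "e \<in> hom H Hs"
      using e by (auto simp: mon_def hom_def)
    have infU: "\<not> finite (UNIV :: 'a set)"
    proof
      assume "finite (UNIV :: 'a set)"
      then have "finite (carrier H)" by (rule rev_finite_subset) simp
      moreover have "|Field \<kappa>| =o |carrier H|"
        using cH inf by (meson card_of_Field_ordIso ordIso_symmetric ordIso_transitive)
      ultimately show False
        using inf by (auto simp: cinfinite_def dest: card_of_ordIso_finite)
    qed
    have "|carrier H| <o |UNIV :: 'a set|"
      using cH big by (rule ordIso_ordLess_trans)
    then have "|UNIV - carrier H| =o |UNIV :: 'a set|"
      by (rule card_of_Un_diff_infinite[OF infU])
    moreover have "|carrier Hs - e ` carrier H| \<le>o |UNIV :: 'a set|" by simp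
    ultimately have "|carrier Hs - e ` carrier H| \<le>o |UNIV - carrier H|"
      by (meson ordIso_symmetric ordLeq_ordIso_trans)
    then obtain j where j: "inj_on j (carrier Hs - e ` carrier H)"
        "j ` (carrier Hs - e ` carrier H) \<subseteq> UNIV - carrier H"
      unfolding card_of_ordLeq[symmetric] by blast
    define b where "b y = (if y \<in> e ` carrier H then inv_into (carrier H) e y else j y)" for y
    have be: "b (e x) = x" if "x \<in> carrier H" for x
      using that eH by (simp add: b_def)
    have inj: "inj_on b (carrier Hs)"
    proof (rule inj_onI)
      fix x y assume xy: "x \<in> carrier Hs" "y \<in> carrier Hs" "b x = b y"
      have *: "b z \<in> carrier H \<longleftrightarrow> z \<in> e ` carrier H" if "z \<in> carrier Hs" for z
        using that j(2) by (auto simp: b_def inv_into_into)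
      show "x = y"
      proof (cases "x \<in> e ` carrier H")
        case True
        then have "y \<in> e ` carrier H" using * xy by metis
        with True xy(3) show ?thesis using be by auto
      next
        case False
        then have "y \<notin> e ` carrier H" using * xy by metis
        with False xy j(1) show ?thesis by (auto simp: b_def dest: inj_onD)
      qed
    qed
    obtain L :: "'a monoid" where L: "comm_group L" "b \<in> iso Hs L"
      using comm_group_transport[OF Hs(1) inj] by blast
    have bhom: "b \<in> hom Hs L" using L(2) by (simp add: iso_def)
    have "b \<circ> e \<in> hom H L" using ehom bhom by (rule hom_compose)
    then have idhom: "id \<in> hom H L"
      using be H by (auto simp: hom_def Pi_iff comm_group.axioms(1)
          monoid.m_closed comm_monoid.axioms(1) comm_group_def)
    interpret idh: group_hom H L id
      using H L(1) idhom by (simp add: group_hom_def group_hom_axioms_def comm_group.axioms(2))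
    have "subgroup (id ` carrier H) L" by (rule idh.img_is_subgroup)
    then have "ab_subgroup H L"
      using H L(1) idhom by (auto simp: ab_subgroup_def hom_def)
    moreover have "|carrier L| =o \<kappa>"
      using L(2) Hs(2) card_of_ordIso unfolding iso_def
      by (metis (no_types, lifting) mem_Collect_eq ordIso_symmetric ordIso_transitive)
    ultimately obtain f where f: "f \<in> mon L G" "\<forall>x\<in>carrier H. f x = x"
      using R by blast
    show ?thesis
      using mon_group_image[OF L(2) f(1)] f(2) be by (intro bexI[of _ "f \<circ> b"]) auto
  qed
  with R show "universal_over \<kappa> H G" unfolding universal_over_def by blast
qed

end

theory Submission
  imports Defs
begin

text \<open>
  Let \<open>U = \<rat> \<oplus> \<Oplus>\<^sub>p \<int>(p\<^sup>\<infinity>)\<close> and let \<open>W\<close> be the direct sum of \<open>\<lambda>\<close> copies of \<open>U\<close>; regrouping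
  summands identifies \<open>W\<close> with the group of the theorem. \<open>W\<close> is divisible of cardinality \<open>\<lambda>\<close>, and
  every abelian group of cardinality at most \<open>\<lambda>\<close> embeds into it. Hence \<open>W\<close> may be taken as the
  extension \<open>H*\<close> in the definition of universality: each \<open>G\<^sub>i\<close> sits inside a copy of \<open>W\<close> inside
  \<open>G\<^sub>i\<^sub>+\<^sub>1\<close>. So \<open>G\<close> is divisible and contains a copy of \<open>W\<close>, and since \<open>|G| \<le> \<lambda>\<close> it also embeds
  into \<open>W\<close>. Divisible subgroups are direct summands (Baer), so \<open>G\<close> and \<open>W\<close> are direct summands of
  each other; as \<open>W\<close> absorbs countable direct sums of itself, a swindle gives \<open>G \<cong> W\<close>.
\<close>

section \<open>Isomorphisms between direct sums\<close>

lemma iso_witnessI: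
  assumes "h \<in> hom G H" "\<And>x. x \<in> carrier G \<Longrightarrow> g (h x) = x"
    and "\<And>y. y \<in> carrier H \<Longrightarrow> g y \<in> carrier G" "\<And>y. y \<in> carrier H \<Longrightarrow> h (g y) = y"
  shows "G \<cong> H"
proof (rule is_isoI, rule isoI)
  show "bij_betw h (carrier G) (carrier H)"
    using assms by (intro bij_betw_byWitness[where f' = g]) (auto simp: hom_def)
qed (rule assms)

lemma DirProd_iso_cong: "G \<cong> G' \<Longrightarrow> H \<cong> H' \<Longrightarrow> group G \<Longrightarrow> G \<times>\<times> H \<cong> G' \<times>\<times> H'"
  by (rule group.DirProd_iso_trans)

lemma DirProd_assoc_iso: "(G \<times>\<times> H) \<times>\<times> K \<cong> G \<times>\<times> (H \<times>\<times> K)"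
  by (rule iso_witnessI[where h = "\<lambda>((x, y), z). (x, y, z)" and g = "\<lambda>(x, y, z). ((x, y), z)"])
    (auto simp: hom_def)

lemma comm_group_DirProd:
  assumes "comm_group G" "comm_group H"
  shows "comm_group (G \<times>\<times> H)"
proof -
  interpret G: comm_group G by fact
  interpret H: comm_group H by fact
  show ?thesis
    by (intro group.group_comm_groupI DirProd_group)
      (auto simp: G.m_comm H.m_comm G.is_group H.is_group)
qed

lemma comm_group_sum_group:
  assumes "\<And>i. i \<in> I \<Longrightarrow> comm_group (G i)"
  shows "comm_group (sum_group I G)"
proof -
  have g: "group (G i)" if "i \<in> I" for i
    using assms[OF that] by (rule comm_group.axioms(2))
  show ?thesis
    by (intro group.group_comm_groupI sum_group)
      (auto simp: g carrier_sum_group PiE_iff intro!: restrict_ext comm_groupE(4)[OF assms])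
qed

text \<open>The isomorphism is precomposition with \<open>f\<close>. A bijection carries supports to
  supports, so finiteness survives in both directions; the restrictions are there because elements
  of \<open>sum_group\<close> are extensional functions.\<close>

lemma sum_group_reindex:
  assumes f: "bij_betw f I J" and F: "\<And>j. j \<in> J \<Longrightarrow> group (F j)"
  shows "sum_group J F \<cong> sum_group I (\<lambda>i. F (f i))"
proof -
  let ?g = "inv_into I f"
  have fJ: "f i \<in> J" if "i \<in> I" for i using f that by (auto simp: bij_betw_def)
  have gI: "?g j \<in> I" "f (?g j) = j" if "j \<in> J" for j
    using f that by (auto simp: bij_betw_def inv_into_into f_inv_into_f)
  have gf: "?g (f i) = i" if "i \<in> I" for i
    using f that by (auto simp: bij_betw_def)
  have F': "group (F (f i))" if "i \<in> I" for i using F fJ that by blast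
  have fin: "finite {i \<in> I. x (f i) \<noteq> \<one>\<^bsub>F (f i)\<^esub>}" if "finite {j \<in> J. x j \<noteq> \<one>\<^bsub>F j\<^esub>}" for x
  proof (rule finite_subset)
    show "{i \<in> I. x (f i) \<noteq> \<one>\<^bsub>F (f i)\<^esub>} \<subseteq> ?g ` {j \<in> J. x j \<noteq> \<one>\<^bsub>F j\<^esub>}"
      using gf fJ by force
  qed (use that in simp)
  have fin': "finite {j \<in> J. y (?g j) \<noteq> \<one>\<^bsub>F j\<^esub>}" if "finite {i \<in> I. y i \<noteq> \<one>\<^bsub>F (f i)\<^esub>}" for y
  proof (rule finite_subset)
    show "{j \<in> J. y (?g j) \<noteq> \<one>\<^bsub>F j\<^esub>} \<subseteq> f ` {i \<in> I. y i \<noteq> \<one>\<^bsub>F (f i)\<^esub>}"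
      using gI by force
  qed (use that in simp)
  show ?thesis
  proof (rule iso_witnessI[where h = "\<lambda>x. \<lambda>i\<in>I. x (f i)" and g = "\<lambda>y. \<lambda>j\<in>J. y (?g j)"])
    show "(\<lambda>x. \<lambda>i\<in>I. x (f i)) \<in> hom (sum_group J F) (sum_group I (\<lambda>i. F (f i)))"
      by (rule homI) (use fin fJ in \<open>auto simp: carrier_sum_group F F' PiE_iff fun_eq_iff cong: conj_cong\<close>)
    fix x assume "x \<in> carrier (sum_group J F)"
    then show "(\<lambda>j\<in>J. (\<lambda>i\<in>I. x (f i)) (?g j)) = x"
      using gI by (auto simp: carrier_sum_group F PiE_iff fun_eq_iff extensional_def)
  next
    fix y assume y: "y \<in> carrier (sum_group I (\<lambda>i. F (f i)))"
    have "y (?g j) \<in> carrier (F j)" if "j \<in> J" for j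
      using y gI[OF that] by (auto simp: carrier_sum_group F' PiE_iff dest!: bspec)
    then show "(\<lambda>j\<in>J. y (?g j)) \<in> carrier (sum_group J F)"
      using fin'[of y] y by (auto simp: carrier_sum_group F F' cong: conj_cong)
    show "(\<lambda>i\<in>I. (\<lambda>j\<in>J. y (?g j)) (f i)) = y"
      using y fJ gf by (auto simp: carrier_sum_group F' PiE_iff fun_eq_iff extensional_def)
  qed
qed

text \<open>Only finiteness of supports needs an argument. The support of a doubly indexed family
  projects onto its set of nontrivial rows and bounds the support of each row; conversely, finitely
  many nontrivial rows of finite support leave only finitely many nontrivial entries.\<close>

lemma sum_group_curry:
  assumes F: "\<And>i k. i \<in> I \<Longrightarrow> k \<in> K \<Longrightarrow> group (F (i, k))"
  shows "sum_group (I \<times> K) F \<cong> sum_group I (\<lambda>i. sum_group K (\<lambda>k. F (i, k)))"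
proof -
  have F': "group (F j)" if "j \<in> I \<times> K" for j using F that by auto
  have S: "group (sum_group K (\<lambda>k. F (i, k)))" if "i \<in> I" for i using F that by simp
  note carr = carrier_sum_group[of "I \<times> K" F, OF F'] carrier_sum_group[OF S]
    carrier_sum_group[of K, OF F]
  let ?h = "\<lambda>x. \<lambda>i\<in>I. \<lambda>k\<in>K. x (i, k)"
  let ?g = "\<lambda>y. \<lambda>j\<in>I \<times> K. y (fst j) (snd j)"
  show ?thesis
  proof (rule iso_witnessI[where h = ?h and g = ?g])
    have closed: "?h x \<in> carrier (sum_group I (\<lambda>i. sum_group K (\<lambda>k. F (i, k))))"
      if x: "x \<in> carrier (sum_group (I \<times> K) F)" for x
    proof -
      let ?S = "{j \<in> I \<times> K. x j \<noteq> \<one>\<^bsub>F j\<^esub>}"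
      have fin: "finite ?S" and xc: "\<And>i k. i \<in> I \<Longrightarrow> k \<in> K \<Longrightarrow> x (i, k) \<in> carrier (F (i, k))"
        using x by (auto simp: carr)
      have 1: "finite {k \<in> K. x (i, k) \<noteq> \<one>\<^bsub>F (i, k)\<^esub>}" if "i \<in> I" for i
        by (rule finite_subset[of _ "snd ` ?S"]) (use that fin in force)+
      have 2: "finite {i \<in> I. (\<lambda>k\<in>K. x (i, k)) \<noteq> (\<lambda>k\<in>K. \<one>\<^bsub>F (i, k)\<^esub>)}"
      proof (rule finite_subset[of _ "fst ` ?S"])
        show "{i \<in> I. (\<lambda>k\<in>K. x (i, k)) \<noteq> (\<lambda>k\<in>K. \<one>\<^bsub>F (i, k)\<^esub>)} \<subseteq> fst ` ?S"
        proof clarify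
          fix i assume i: "i \<in> I" "(\<lambda>k\<in>K. x (i, k)) \<noteq> (\<lambda>k\<in>K. \<one>\<^bsub>F (i, k)\<^esub>)"
          then obtain k where "k \<in> K" "x (i, k) \<noteq> \<one>\<^bsub>F (i, k)\<^esub>"
            by (metis (mono_tags, lifting) restrict_ext)
          with i show "i \<in> fst ` ?S" by force
        qed
      qed (use fin in simp)
      show ?thesis
        using 1 2 xc by (auto simp: carr cong: conj_cong)
    qed
    show "?h \<in> hom (sum_group (I \<times> K) F) (sum_group I (\<lambda>i. sum_group K (\<lambda>k. F (i, k))))"
      by (rule homI) (use closed in \<open>auto simp: fun_eq_iff\<close>)
    fix x assume "x \<in> carrier (sum_group (I \<times> K) F)"
    then show "?g (?h x) = x"
      by (auto simp: carr PiE_iff fun_eq_iff extensional_def)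
  next
    fix y assume y: "y \<in> carrier (sum_group I (\<lambda>i. sum_group K (\<lambda>k. F (i, k))))"
    then have yi: "y i \<in> (\<Pi>\<^sub>E k\<in>K. carrier (F (i, k)))" "finite {k \<in> K. y i k \<noteq> \<one>\<^bsub>F (i, k)\<^esub>}"
      if "i \<in> I" for i
    proof -
      have "y i \<in> carrier (sum_group K (\<lambda>k. F (i, k)))" using y that by (auto simp: carr(2))
      then show "y i \<in> (\<Pi>\<^sub>E k\<in>K. carrier (F (i, k)))" "finite {k \<in> K. y i k \<noteq> \<one>\<^bsub>F (i, k)\<^esub>}"
        using that by (auto simp: carr(3))
    qed
    let ?S = "{i \<in> I. y i \<noteq> (\<lambda>k\<in>K. \<one>\<^bsub>F (i, k)\<^esub>)}"
    have fin: "finite ?S" using y by (auto simp: carr)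
    have "finite {j \<in> I \<times> K. y (fst j) (snd j) \<noteq> \<one>\<^bsub>F j\<^esub>}"
      by (rule finite_subset[of _ "SIGMA i:?S. {k \<in> K. y i k \<noteq> \<one>\<^bsub>F (i, k)\<^esub>}"])
        (use fin yi in \<open>auto intro!: finite_SigmaI\<close>)
    moreover have "y i k \<in> carrier (F (i, k))" if "i \<in> I" "k \<in> K" for i k
      using yi(1)[OF that(1)] that(2) by auto
    ultimately show "?g y \<in> carrier (sum_group (I \<times> K) F)"
      by (auto simp: carr cong: conj_cong)
    show "?h (?g y) = y"
      using y yi by (fastforce simp: carr PiE_iff fun_eq_iff extensional_def)
  qed
qed

text \<open>Both iterated sums are curried forms of the sum over the product of the index sets, up
  to exchanging the two factors.\<close>

lemma sum_group_swap:
  assumes F: "\<And>i k. i \<in> I \<Longrightarrow> k \<in> K \<Longrightarrow> group (F i k)"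
  shows "sum_group I (\<lambda>i. sum_group K (\<lambda>k. F i k)) \<cong> sum_group K (\<lambda>k. sum_group I (\<lambda>i. F i k))"
proof -
  have g: "group (sum_group (I \<times> K) (\<lambda>(i, k). F i k))"
    by (intro sum_group) (use F in auto)
  have 1: "sum_group (I \<times> K) (\<lambda>(i, k). F i k) \<cong> sum_group I (\<lambda>i. sum_group K (\<lambda>k. F i k))"
    using sum_group_curry[of I K "\<lambda>(i, k). F i k"] F by simp
  have "sum_group (I \<times> K) (\<lambda>(i, k). F i k)
      \<cong> sum_group (K \<times> I) (\<lambda>j. (\<lambda>(i, k). F i k) (prod.swap j))"
    by (rule sum_group_reindex) (use F in \<open>auto simp: bij_betw_def inj_on_def\<close>)
  also have "sum_group (K \<times> I) (\<lambda>j. (\<lambda>(i, k). F i k) (prod.swap j))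
      \<cong> sum_group K (\<lambda>k. sum_group I (\<lambda>i. F i k))"
    using sum_group_curry[of K I "\<lambda>j. (\<lambda>(i, k). F i k) (prod.swap j)"] F by simp
  finally show ?thesis
    using group.iso_sym[OF g 1] iso_trans by blast
qed

lemma sum_group_DirProd:
  assumes G: "\<And>i. i \<in> I \<Longrightarrow> group (G i)" and H: "\<And>i. i \<in> I \<Longrightarrow> group (H i)"
  shows "sum_group I (\<lambda>i. G i \<times>\<times> H i) \<cong> sum_group I G \<times>\<times> sum_group I H"
proof -
  have P: "group (G i \<times>\<times> H i)" if "i \<in> I" for i
    using that G H by (simp add: DirProd_group)
  note carr = carrier_sum_group[of I, OF P] carrier_sum_group[of I, OF G] carrier_sum_group[of I, OF H]
  let ?h = "\<lambda>x. (\<lambda>i\<in>I. fst (x i), \<lambda>i\<in>I. snd (x i))"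
  let ?g = "\<lambda>y. \<lambda>i\<in>I. (fst y i, snd y i)"
  show ?thesis
  proof (rule iso_witnessI[where h = ?h and g = ?g])
    have closed: "?h x \<in> carrier (sum_group I G \<times>\<times> sum_group I H)"
      if x: "x \<in> carrier (sum_group I (\<lambda>i. G i \<times>\<times> H i))" for x
    proof -
      have fin: "finite {i \<in> I. x i \<noteq> (\<one>\<^bsub>G i\<^esub>, \<one>\<^bsub>H i\<^esub>)}"
        and xc: "x i \<in> carrier (G i) \<times> carrier (H i)" if "i \<in> I" for i
        using x that by (auto simp: carr dest: PiE_mem)
      have "finite {i \<in> I. fst (x i) \<noteq> \<one>\<^bsub>G i\<^esub>}" "finite {i \<in> I. snd (x i) \<noteq> \<one>\<^bsub>H i\<^esub>}"
        using x by (auto simp: carr elim!: rev_finite_subset)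
      then show ?thesis
        using xc by (force simp: carr cong: conj_cong)
    qed
    show "?h \<in> hom (sum_group I (\<lambda>i. G i \<times>\<times> H i)) (sum_group I G \<times>\<times> sum_group I H)"
      by (rule homI) (use closed in \<open>auto simp: fun_eq_iff mult_DirProd'\<close>)
    fix x assume "x \<in> carrier (sum_group I (\<lambda>i. G i \<times>\<times> H i))"
    then show "?g (?h x) = x"
      by (auto simp: carr PiE_iff fun_eq_iff extensional_def)
  next
    fix y assume y: "y \<in> carrier (sum_group I G \<times>\<times> sum_group I H)"
    have "finite {i \<in> I. (fst y i, snd y i) \<noteq> (\<one>\<^bsub>G i\<^esub>, \<one>\<^bsub>H i\<^esub>)}"
      by (rule finite_subset[of _ "{i \<in> I. fst y i \<noteq> \<one>\<^bsub>G i\<^esub>} \<union> {i \<in> I. snd y i \<noteq> \<one>\<^bsub>H i\<^esub>}"])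
        (use y in \<open>auto simp: carr\<close>)
    then show "?g y \<in> carrier (sum_group I (\<lambda>i. G i \<times>\<times> H i))"
      using y by (auto simp: carr dest: PiE_mem cong: conj_cong)
    show "?h (?g y) = y"
      using y by (cases y) (auto simp: carr PiE_iff fun_eq_iff extensional_def)
  qed
qed

text \<open>The shift on sequences: the entry at \<open>0\<close> is split off and the others move
  down by one. This drives the swindle below.\<close>

lemma sum_group_nat_split:
  assumes A: "group A"
  shows "sum_group (UNIV :: nat set) (\<lambda>_. A) \<cong> A \<times>\<times> sum_group (UNIV :: nat set) (\<lambda>_. A)"
proof -
  note carr = carrier_sum_group[of "UNIV :: nat set" "\<lambda>_. A", OF A]
  let ?h = "\<lambda>x :: nat \<Rightarrow> _. (x 0, \<lambda>n. x (Suc n))"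
  let ?g = "\<lambda>y. case_nat (fst y) (snd y)"
  show ?thesis
  proof (rule iso_witnessI[where h = ?h and g = ?g])
    have closed: "?h x \<in> carrier (A \<times>\<times> sum_group UNIV (\<lambda>_. A))"
      if x: "x \<in> carrier (sum_group UNIV (\<lambda>_. A))" for x
    proof -
      have "finite (Suc -` {i. x i \<noteq> \<one>\<^bsub>A\<^esub>})"
        by (rule finite_vimageI) (use x in \<open>auto simp: carr\<close>)
      then show ?thesis using x by (auto simp: carr vimage_def)
    qed
    show "?h \<in> hom (sum_group UNIV (\<lambda>_. A)) (A \<times>\<times> sum_group UNIV (\<lambda>_. A))"
      by (rule homI) (use closed in \<open>auto simp: fun_eq_iff\<close>)
    show "?g (?h x) = x" for x :: "nat \<Rightarrow> _"
      by (auto simp: fun_eq_iff split: nat.split)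
  next
    fix y assume y: "y \<in> carrier (A \<times>\<times> sum_group (UNIV :: nat set) (\<lambda>_. A))"
    have "{i. ?g y i \<noteq> \<one>\<^bsub>A\<^esub>} \<subseteq> insert 0 (Suc ` {i. snd y i \<noteq> \<one>\<^bsub>A\<^esub>})"
    proof
      fix i assume "i \<in> {i. ?g y i \<noteq> \<one>\<^bsub>A\<^esub>}"
      then show "i \<in> insert 0 (Suc ` {i. snd y i \<noteq> \<one>\<^bsub>A\<^esub>})" by (cases i) auto
    qed
    then have "finite {i. ?g y i \<noteq> \<one>\<^bsub>A\<^esub>}"
      by (rule finite_subset) (use y in \<open>auto simp: carr\<close>)
    then show "?g y \<in> carrier (sum_group UNIV (\<lambda>_. A))"
      using y by (auto simp: carr PiE_iff split: nat.split)
  qed auto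
qed

text \<open>An infinite \<open>I\<close> is equipotent with its product with the natural numbers, so
  reindexing and currying turn the sum over \<open>I\<close> into countably many copies of
  itself.\<close>

lemma sum_group_nat_absorb:
  assumes I: "infinite I" and A: "group A"
  shows "sum_group (UNIV :: nat set) (\<lambda>_. sum_group I (\<lambda>_. A)) \<cong> sum_group I (\<lambda>_. A)"
proof -
  have "|UNIV :: nat set| \<le>o |I|" using I by (simp add: infinite_iff_card_of_nat)
  then have "|(UNIV :: nat set) \<times> I| =o |I|"
    using I card_of_Times_infinite[of I "UNIV :: nat set"] by auto
  then obtain f where f: "bij_betw f ((UNIV :: nat set) \<times> I) I"
    using card_of_ordIso by blast
  have "sum_group I (\<lambda>_. A) \<cong> sum_group ((UNIV :: nat set) \<times> I) (\<lambda>_. A)"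
    using sum_group_reindex[OF f, of "\<lambda>_. A"] A by simp
  also have "\<dots> \<cong> sum_group (UNIV :: nat set) (\<lambda>_. sum_group I (\<lambda>_. A))"
    using sum_group_curry[of "UNIV :: nat set" I "\<lambda>_. A"] A by simp
  finally show ?thesis
    by (rule group.iso_sym[rotated]) (simp add: A)
qed

section \<open>Divisible groups\<close>

definition divisible_group :: "('a, 'b) monoid_scheme \<Rightarrow> bool" where
  "divisible_group G \<longleftrightarrow>
     (\<forall>n>0. \<forall>x\<in>carrier G. \<exists>y\<in>carrier G. y [^]\<^bsub>G\<^esub> (n::nat) = x)"

text \<open>Supplies the upper bounds in both applications of Zorn's lemma below.\<close>

lemma subgroup_Union_chain:
  assumes G: "group G" and ne: "\<C> \<noteq> {}" and sub: "\<And>H. H \<in> \<C> \<Longrightarrow> subgroup H G"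
    and chain: "\<And>H K. H \<in> \<C> \<Longrightarrow> K \<in> \<C> \<Longrightarrow> H \<subseteq> K \<or> K \<subseteq> H"
  shows "subgroup (\<Union>\<C>) G"
proof
  show "\<Union>\<C> \<subseteq> carrier G" using sub subgroup.subset by blast
  show "\<one>\<^bsub>G\<^esub> \<in> \<Union>\<C>" using ne sub subgroup.one_closed by blast
  show "inv\<^bsub>G\<^esub> x \<in> \<Union>\<C>" if "x \<in> \<Union>\<C>" for x
    using that sub subgroup.m_inv_closed by fastforce
  show "x \<otimes>\<^bsub>G\<^esub> y \<in> \<Union>\<C>" if xy: "x \<in> \<Union>\<C>" "y \<in> \<Union>\<C>" for x y
  proof -
    obtain H K where HK: "H \<in> \<C>" "K \<in> \<C>" "x \<in> H" "y \<in> K" using xy by blast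
    from chain[OF HK(1,2)] show ?thesis
      using HK sub subgroup.m_closed by (metis UnionI subsetD)
  qed
qed

text \<open>For a subgroup \<open>H\<close> of a commutative group this is the subgroup generated by
  \<open>H\<close> and \<open>k\<close>. The explicit normal form of its elements allows conditions
  on an enlarged graph to be checked element by element.\<close>

definition adjoin :: "('a, 'b) monoid_scheme \<Rightarrow> 'a set \<Rightarrow> 'a \<Rightarrow> 'a set" where
  "adjoin G H k = {h \<otimes>\<^bsub>G\<^esub> k [^]\<^bsub>G\<^esub> (n::int) |h n. h \<in> H}"

lemma
  assumes G: "comm_group G" and H: "subgroup H G" and k: "k \<in> carrier G"
  shows subgroup_adjoin: "subgroup (adjoin G H k) G"
    and adjoin_superset: "H \<subseteq> adjoin G H k"
    and mem_adjoin: "k \<in> adjoin G H k"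
proof -
  interpret G: comm_group G by fact
  interpret H: subgroup H G by fact
  show "subgroup (adjoin G H k) G"
  proof
    show "adjoin G H k \<subseteq> carrier G" using k by (auto simp: adjoin_def)
    show "\<one>\<^bsub>G\<^esub> \<in> adjoin G H k"
      unfolding adjoin_def by (rule CollectI, intro exI[of _ "\<one>\<^bsub>G\<^esub>"] exI[of _ 0]) simp
  next
    fix x assume "x \<in> adjoin G H k"
    then obtain h n where x: "x = h \<otimes>\<^bsub>G\<^esub> k [^]\<^bsub>G\<^esub> (n::int)" "h \<in> H" by (auto simp: adjoin_def)
    have "inv\<^bsub>G\<^esub> x = inv\<^bsub>G\<^esub> h \<otimes>\<^bsub>G\<^esub> k [^]\<^bsub>G\<^esub> (- n)"
      using x k by (simp add: G.inv_mult G.int_pow_neg)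
    then show "inv\<^bsub>G\<^esub> x \<in> adjoin G H k"
      using x(2) by (auto simp: adjoin_def)
  next
    fix x y assume "x \<in> adjoin G H k" "y \<in> adjoin G H k"
    then obtain h n h' n' where x: "x = h \<otimes>\<^bsub>G\<^esub> k [^]\<^bsub>G\<^esub> (n::int)" "h \<in> H"
      and y: "y = h' \<otimes>\<^bsub>G\<^esub> k [^]\<^bsub>G\<^esub> (n'::int)" "h' \<in> H" by (auto simp: adjoin_def)
    have "x \<otimes>\<^bsub>G\<^esub> y = (h \<otimes>\<^bsub>G\<^esub> h') \<otimes>\<^bsub>G\<^esub> k [^]\<^bsub>G\<^esub> (n + n')"
      using x y k by (simp add: G.int_pow_mult G.m_ac)
    then show "x \<otimes>\<^bsub>G\<^esub> y \<in> adjoin G H k"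
      using x(2) y(2) by (auto simp: adjoin_def)
  qed
  show "H \<subseteq> adjoin G H k"
  proof
    fix h assume h: "h \<in> H"
    show "h \<in> adjoin G H k"
      unfolding adjoin_def by (rule CollectI, intro exI[of _ h] exI[of _ 0]) (use h in simp)
  qed
  show "k \<in> adjoin G H k"
    unfolding adjoin_def by (rule CollectI, intro exI[of _ "\<one>\<^bsub>G\<^esub>"] exI[of _ 1]) (use k in simp)
qed

section \<open>Extending homomorphisms into divisible groups\<close>

lemma int_pow_DirProd:
  assumes "group G" "group H" "x \<in> carrier G" "y \<in> carrier H"
  shows "(x, y) [^]\<^bsub>G \<times>\<times> H\<^esub> (n::int) = (x [^]\<^bsub>G\<^esub> n, y [^]\<^bsub>H\<^esub> n)"
proof -
  interpret P: group "G \<times>\<times> H" using assms by (intro DirProd_group)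
  have "fst \<in> hom (G \<times>\<times> H) G" "snd \<in> hom (G \<times>\<times> H) H"
    by (auto simp: hom_def)
  then have "fst ((x, y) [^]\<^bsub>G \<times>\<times> H\<^esub> n) = x [^]\<^bsub>G\<^esub> n" "snd ((x, y) [^]\<^bsub>G \<times>\<times> H\<^esub> n) = y [^]\<^bsub>H\<^esub> n"
    using hom_int_pow[of fst "G \<times>\<times> H" G "(x, y)" n] hom_int_pow[of snd "G \<times>\<times> H" H "(x, y)" n] assms
    by (auto simp: P.is_group)
  then show ?thesis by (metis prod.collapse)
qed

text \<open>Division with remainder: the remainder of \<open>n\<close> modulo \<open>m\<close> is
  again an exponent that puts \<open>a\<close> into \<open>H\<close>, and it is smaller than
  \<open>m\<close>, so minimality forces it to vanish.\<close>

lemma (in group) int_pow_mem_subgroup_dvd: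
  fixes m :: nat and n :: int
  assumes H: "subgroup H G" and a: "a \<in> carrier G" and m: "m > 0" "a [^] m \<in> H"
    and least: "\<And>k. 0 < k \<Longrightarrow> k < m \<Longrightarrow> a [^] (k::nat) \<notin> H" and n: "a [^] n \<in> H"
  shows "int m dvd n"
proof (rule ccontr)
  assume nd: "\<not> int m dvd n"
  define r where "r = nat (n mod int m)"
  have r: "0 < r" "r < m" "int r = n - int m * (n div int m)"
    using m(1) nd pos_mod_bound[of "int m" n] pos_mod_sign[of "int m" n]
    by (auto simp: r_def dvd_eq_mod_eq_0 minus_mult_div_eq_mod nat_less_iff)
  have "a [^] r = a [^] int r" by (simp add: int_pow_int)
  also have "\<dots> = a [^] n \<otimes> inv ((a [^] m) [^] (n div int m))"
    unfolding r(3) using a by (simp add: int_pow_diff int_pow_pow flip: int_pow_int)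
  also have "\<dots> \<in> H"
    using n m(2) H subgroup_int_pow_closed[OF H m(2)]
    by (intro subgroup.m_closed[OF H] subgroup.m_inv_closed[OF H])
  finally show False using least r by blast
qed

text \<open>Partial homomorphisms are given by their graphs, which are subgroups of \<open>A \<times>\<times> D\<close>.\<close>

theorem Baer_extension:
  assumes A: "comm_group A" and D: "comm_group D" and div: "divisible_group D"
    and R0: "subgroup R0 (A \<times>\<times> D)" "\<And>d. (\<one>\<^bsub>A\<^esub>, d) \<in> R0 \<Longrightarrow> d = \<one>\<^bsub>D\<^esub>"
  shows "\<exists>g\<in>hom A D. \<forall>a d. (a, d) \<in> R0 \<longrightarrow> g a = d"
proof -
  interpret A: comm_group A by fact
  interpret D: comm_group D by fact
  interpret P: comm_group "A \<times>\<times> D" using A D by (rule comm_group_DirProd)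
  \<comment> \<open>For a subgroup of the product, a trivial fibre over the neutral element already
    makes it the graph of a function. Stated this way, the condition passes to unions of chains at
    once.\<close>
  define \<A> where "\<A> = {R. subgroup R (A \<times>\<times> D) \<and> R0 \<subseteq> R \<and> (\<forall>d. (\<one>\<^bsub>A\<^esub>, d) \<in> R \<longrightarrow> d = \<one>\<^bsub>D\<^esub>)}"
  have "\<exists>M\<in>\<A>. \<forall>R\<in>\<A>. M \<subseteq> R \<longrightarrow> R = M"
  proof (rule subset_Zorn_nonempty)
    show "\<A> \<noteq> {}" using R0 by (auto simp: \<A>_def)
    fix \<C> assume \<C>: "\<C> \<noteq> {}" "subset.chain \<A> \<C>"
    have "subgroup (\<Union>\<C>) (A \<times>\<times> D)"
    proof (rule subgroup_Union_chain)
      show "H \<subseteq> K \<or> K \<subseteq> H" if "H \<in> \<C>" "K \<in> \<C>" for H K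
        using \<C>(2) that unfolding subset.chain_def by blast
    qed (use \<C> in \<open>auto simp: subset.chain_def \<A>_def P.is_group\<close>)
    with \<C> show "\<Union>\<C> \<in> \<A>" by (auto simp: subset.chain_def \<A>_def)
  qed
  then obtain M where MA: "M \<in> \<A>" and max: "\<And>R. R \<in> \<A> \<Longrightarrow> M \<subseteq> R \<Longrightarrow> R = M"
    by metis
  have M: "subgroup M (A \<times>\<times> D)" "R0 \<subseteq> M" "\<And>d. (\<one>\<^bsub>A\<^esub>, d) \<in> M \<Longrightarrow> d = \<one>\<^bsub>D\<^esub>"
    using MA by (auto simp: \<A>_def)
  interpret M: subgroup M "A \<times>\<times> D" by (rule M)
  have carr: "a \<in> carrier A" "d \<in> carrier D" if "(a, d) \<in> M" for a d
    using M.mem_carrier[OF that] by auto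
  have unique: "d = d'" if "(a, d) \<in> M" "(a, d') \<in> M" for a d d'
  proof -
    have "(a, d) \<otimes>\<^bsub>A \<times>\<times> D\<^esub> inv\<^bsub>A \<times>\<times> D\<^esub> (a, d') \<in> M" using that by blast
    then have "(\<one>\<^bsub>A\<^esub>, d \<otimes>\<^bsub>D\<^esub> inv\<^bsub>D\<^esub> d') \<in> M"
      using that[THEN carr(1)] that[THEN carr(2)] by (simp add: A.is_group D.is_group)
    then show ?thesis
      using M(3) that[THEN carr(2)] D.right_cancel D.r_inv by (metis D.inv_closed)
  qed
  have total: "\<exists>d. (a, d) \<in> M" if a: "a \<in> carrier A" for a
  proof -
    let ?H = "fst ` M"
    have "group_hom (A \<times>\<times> D) A fst"
      by (auto simp: group_hom_def group_hom_axioms_def hom_def P.is_group A.is_group)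
    then have H: "subgroup ?H A" by (rule group_hom.subgroup_img_is_subgroup) (rule M)
    \<comment> \<open>The prospective value \<open>t\<close> at \<open>a\<close> has to agree with
      \<open>M\<close> on every power of \<open>a\<close> that already lies in the domain.\<close>
    have "\<exists>t\<in>carrier D. \<forall>n::int. a [^]\<^bsub>A\<^esub> n \<in> ?H \<longrightarrow> (a [^]\<^bsub>A\<^esub> n, t [^]\<^bsub>D\<^esub> n) \<in> M"
    proof (cases "\<exists>m::nat. m > 0 \<and> a [^]\<^bsub>A\<^esub> m \<in> ?H")
      \<comment> \<open>Only the zeroth power of \<open>a\<close> lies in the domain, so there is no
        constraint and the neutral element serves as \<open>t\<close>.\<close>
      case False
      have "n = 0" if "a [^]\<^bsub>A\<^esub> n \<in> ?H" for n :: int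
      proof (rule ccontr)
        assume n: "n \<noteq> 0"
        have "inv\<^bsub>A\<^esub> (a [^]\<^bsub>A\<^esub> n) \<in> ?H" using H that by (rule subgroup.m_inv_closed)
        then have "a [^]\<^bsub>A\<^esub> (- n) \<in> ?H" using a by (simp add: A.int_pow_neg)
        then have "a [^]\<^bsub>A\<^esub> nat \<bar>n\<bar> \<in> ?H"
          using that unfolding int_pow_int[symmetric] by (cases "n \<ge> 0") auto
        moreover have "nat \<bar>n\<bar> > 0" using n by simp
        ultimately show False using False by blast
      qed
      moreover have "(a [^]\<^bsub>A\<^esub> (0::int), \<one>\<^bsub>D\<^esub> [^]\<^bsub>D\<^esub> (0::int)) \<in> M"
        using M.one_closed by simp
      ultimately show ?thesis by (metis D.one_closed)
    next
      case True
      define m where "m = (LEAST m::nat. m > 0 \<and> a [^]\<^bsub>A\<^esub> m \<in> ?H)"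
      have "m > 0 \<and> a [^]\<^bsub>A\<^esub> m \<in> ?H"
        unfolding m_def by (rule LeastI_ex) (rule True)
      then have m: "m > 0" "a [^]\<^bsub>A\<^esub> m \<in> ?H" by simp_all
      have least: "a [^]\<^bsub>A\<^esub> k \<notin> ?H" if "0 < k" "k < m" for k
        using not_less_Least[of k "\<lambda>m. m > 0 \<and> a [^]\<^bsub>A\<^esub> m \<in> ?H"] that unfolding m_def by blast
      obtain d where d: "(a [^]\<^bsub>A\<^esub> m, d) \<in> M" using m(2) by auto
      \<comment> \<open>This is where divisibility enters: \<open>t\<close> is an
        \<open>m\<close>-th root of the value at the \<open>m\<close>-th power of \<open>a\<close>.
        All relevant exponents are multiples of \<open>m\<close>, so agreement at \<open>m\<close>
        gives agreement everywhere.\<close>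
      obtain t where t: "t \<in> carrier D" "t [^]\<^bsub>D\<^esub> m = d"
        using div m(1) carr(2)[OF d] by (auto simp: divisible_group_def)
      have "(a [^]\<^bsub>A\<^esub> n, t [^]\<^bsub>D\<^esub> n) \<in> M" if n: "a [^]\<^bsub>A\<^esub> n \<in> ?H" for n :: int
      proof -
        have "int m dvd n"
          using A.int_pow_mem_subgroup_dvd[OF H a m least n] .
        then obtain k where k: "n = int m * k" by blast
        have "(a [^]\<^bsub>A\<^esub> m, d) [^]\<^bsub>A \<times>\<times> D\<^esub> k \<in> M"
          using d by (rule P.subgroup_int_pow_closed[OF M(1)])
        also have "(a [^]\<^bsub>A\<^esub> m, d) [^]\<^bsub>A \<times>\<times> D\<^esub> k = (a [^]\<^bsub>A\<^esub> n, t [^]\<^bsub>D\<^esub> n)"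
          using a t by (auto simp: int_pow_DirProd A.is_group D.is_group k A.int_pow_pow D.int_pow_pow
              simp flip: int_pow_int)
        finally show ?thesis .
      qed
      with t show ?thesis by blast
    qed
    then obtain t where t: "t \<in> carrier D"
      and tM: "\<And>n::int. a [^]\<^bsub>A\<^esub> n \<in> ?H \<Longrightarrow> (a [^]\<^bsub>A\<^esub> n, t [^]\<^bsub>D\<^esub> n) \<in> M" by blast
    have at: "(a, t) \<in> carrier (A \<times>\<times> D)" using a t by simp
    let ?R = "adjoin (A \<times>\<times> D) M (a, t)"
    \<comment> \<open>An element of the new graph over the neutral element expresses a power of
      \<open>a\<close> as the inverse of a domain element. That power then lies in the domain, where
      \<open>t\<close> agrees with \<open>M\<close>, so the element was already in
      \<open>M\<close>.\<close>
    have "d = \<one>\<^bsub>D\<^esub>" if "(\<one>\<^bsub>A\<^esub>, d) \<in> ?R" for d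
    proof -
      obtain x e n where xe: "(x, e) \<in> M" "x \<otimes>\<^bsub>A\<^esub> a [^]\<^bsub>A\<^esub> (n::int) = \<one>\<^bsub>A\<^esub>" "d = e \<otimes>\<^bsub>D\<^esub> t [^]\<^bsub>D\<^esub> n"
        using \<open>(\<one>\<^bsub>A\<^esub>, d) \<in> ?R\<close> a t
        by (auto simp: adjoin_def int_pow_DirProd A.is_group D.is_group)
      have "inv\<^bsub>A\<^esub> x = a [^]\<^bsub>A\<^esub> n"
        using xe a carr by (metis A.inv_equality A.int_pow_closed A.m_comm)
      then have "a [^]\<^bsub>A\<^esub> n \<in> ?H"
        using subgroup.m_inv_closed[OF H, of x] xe(1) by force
      from M.m_closed[OF xe(1) tM[OF this]] have "(\<one>\<^bsub>A\<^esub>, d) \<in> M"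
        using xe by simp
      then show ?thesis by (rule M(3))
    qed
    then have "?R \<in> \<A>"
      using subgroup_adjoin[OF P.comm_group_axioms M(1) at] adjoin_superset[OF P.comm_group_axioms M(1) at] M(2)
      by (auto simp: \<A>_def)
    then have "?R = M"
      by (rule max) (rule adjoin_superset[OF P.comm_group_axioms M(1) at])
    then show ?thesis using mem_adjoin[OF P.comm_group_axioms M(1) at] by auto
  qed
  define g where "g a = (THE d. (a, d) \<in> M)" for a
  have g: "g a = d" if "(a, d) \<in> M" for a d
    unfolding g_def using that unique by blast
  have "g \<in> hom A D"
  proof (rule homI)
    fix a assume "a \<in> carrier A"
    then obtain d where d: "(a, d) \<in> M" using total by blast
    then show "g a \<in> carrier D" using g[OF d] carr by simp
    fix b assume "b \<in> carrier A"
    then obtain e where e: "(b, e) \<in> M" using total by blast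
    have "(a \<otimes>\<^bsub>A\<^esub> b, d \<otimes>\<^bsub>D\<^esub> e) \<in> M" using M.m_closed[OF d e] by simp
    then show "g (a \<otimes>\<^bsub>A\<^esub> b) = g a \<otimes>\<^bsub>D\<^esub> g b" using g d e by simp
  qed
  with g M(2) show ?thesis by blast
qed

text \<open>Baer's theorem, applied to the graph of the inverse of \<open>f\<close> on its image,
  gives a retraction \<open>r\<close> of \<open>G\<close> onto \<open>D\<close>. The complement
  \<open>K\<close> is the kernel of \<open>r\<close>, and each \<open>x\<close> decomposes as
  \<open>f (r x)\<close> times an element of that kernel.\<close>

theorem divisible_subgroup_splits:
  fixes G :: "'a monoid" and D :: "'b monoid"
  assumes G: "comm_group G" and D: "comm_group D" and div: "divisible_group D" and f: "f \<in> mon D G"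
  shows "\<exists>K :: 'a monoid. group K \<and> G \<cong> D \<times>\<times> K"
proof -
  interpret G: comm_group G by fact
  interpret D: comm_group D by fact
  have fh: "f \<in> hom D G" and inj: "inj_on f (carrier D)" using f by (auto simp: mon_def)
  interpret f: group_hom D G f
    using fh by (simp add: group_hom_def group_hom_axioms_def G.is_group D.is_group)
  let ?R = "(\<lambda>d. (f d, d)) ` carrier D"
  have P: "group_hom D (G \<times>\<times> D) (\<lambda>d. (f d, d))"
    using fh by (auto simp: group_hom_def group_hom_axioms_def G.is_group D.is_group DirProd_group hom_def)
  have "subgroup ?R (G \<times>\<times> D)" using P by (rule group_hom.img_is_subgroup)
  moreover have "d = \<one>\<^bsub>D\<^esub>" if "(\<one>\<^bsub>G\<^esub>, d) \<in> ?R" for d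
    using that inj f.inj_on_one_iff by auto
  ultimately obtain r where r: "r \<in> hom G D" and rf: "\<And>d. d \<in> carrier D \<Longrightarrow> r (f d) = d"
    using Baer_extension[OF G D div, of ?R] by auto
  interpret r: group_hom G D r
    using r by (simp add: group_hom_def group_hom_axioms_def G.is_group D.is_group)
  let ?K = "G\<lparr>carrier := kernel G D r\<rparr>"
  have K: "group ?K"
    using r.subgroup_kernel G.subgroup_imp_group by blast
  let ?h = "\<lambda>(d, k). f d \<otimes>\<^bsub>G\<^esub> k"
  let ?g = "\<lambda>x. (r x, inv\<^bsub>G\<^esub> f (r x) \<otimes>\<^bsub>G\<^esub> x)"
  have "D \<times>\<times> ?K \<cong> G"
  proof (rule iso_witnessI[where h = ?h and g = ?g])
    show "?h \<in> hom (D \<times>\<times> ?K) G"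
      by (rule homI) (auto simp: kernel_def G.m_ac)
    show "?g (?h x) = x" if "x \<in> carrier (D \<times>\<times> ?K)" for x
      using that by (auto simp: kernel_def rf simp flip: G.m_assoc)
    fix y assume y: "y \<in> carrier G"
    then show "?g y \<in> carrier (D \<times>\<times> ?K)"
      by (auto simp: kernel_def rf)
    show "?h (?g y) = y"
      using y by (simp flip: G.m_assoc)
  qed
  then have "G \<cong> D \<times>\<times> ?K"
    by (rule group.iso_sym[rotated]) (simp add: DirProd_group K D.is_group)
  with K show ?thesis by blast
qed

section \<open>Prufer groups and direct sums of divisible groups\<close>

lemma comm_group_rat_group: "comm_group rat_group"
proof (rule comm_groupI)
  show "\<exists>y\<in>carrier rat_group. y \<otimes>\<^bsub>rat_group\<^esub> x = \<one>\<^bsub>rat_group\<^esub>" for x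
    by (rule bexI[of _ "- x"]) (auto simp: rat_group_def)
qed (auto simp: rat_group_def)

lemma nat_pow_rat_group: "x [^]\<^bsub>rat_group\<^esub> (n::nat) = of_nat n * x"
proof -
  interpret comm_group rat_group by (rule comm_group_rat_group)
  show ?thesis by (induction n) (auto simp: rat_group_def algebra_simps)
qed

lemma divisible_rat_group: "divisible_group rat_group"
  unfolding divisible_group_def
proof (intro allI impI ballI)
  fix n :: nat and x assume "0 < n"
  then show "\<exists>y\<in>carrier rat_group. y [^]\<^bsub>rat_group\<^esub> n = x"
    by (intro bexI[of _ "x / of_nat n"]) (auto simp: nat_pow_rat_group, auto simp: rat_group_def)
qed

lemma comm_group_prufer_group:
  assumes "Factorial_Ring.prime p"
  shows "comm_group (prufer_group p)"
proof (rule comm_groupI)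
  fix x y assume xy: "x \<in> carrier (prufer_group p)" "y \<in> carrier (prufer_group p)"
  then obtain m n where "x ^ (p ^ m) = 1" "y ^ (p ^ n) = 1" by (auto simp: prufer_group_def)
  then have "(x * y) ^ (p ^ (m + n)) = 1"
    by (simp add: power_mult_distrib power_add power_mult)
      (metis mult.commute power_mult power_one)
  then show "x \<otimes>\<^bsub>prufer_group p\<^esub> y \<in> carrier (prufer_group p)"
    by (auto simp: prufer_group_def)
next
  fix x assume "x \<in> carrier (prufer_group p)"
  then obtain m where m: "x ^ (p ^ m) = 1" by (auto simp: prufer_group_def)
  then have "x \<noteq> 0" using assms by (auto simp: power_0_left split: if_splits)
  then show "\<exists>y\<in>carrier (prufer_group p). y \<otimes>\<^bsub>prufer_group p\<^esub> x = \<one>\<^bsub>prufer_group p\<^esub>"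
    using m by (intro bexI[of _ "inverse x"]) (auto simp: prufer_group_def power_inverse)
qed (auto simp: prufer_group_def)

lemma nat_pow_prufer_group: "x [^]\<^bsub>prufer_group p\<^esub> (n::nat) = x ^ n"
  by (induction n) (simp_all add: prufer_group_def nat_pow_def)

text \<open>Roots are extracted one prime factor at a time, by induction on the exponent.\<close>

lemma divisible_groupI_prime:
  assumes G: "group G"
    and p: "\<And>p x. Factorial_Ring.prime p \<Longrightarrow> x \<in> carrier G \<Longrightarrow> \<exists>y\<in>carrier G. y [^]\<^bsub>G\<^esub> (p::nat) = x"
  shows "divisible_group G"
proof -
  interpret group G by fact
  have "\<exists>y\<in>carrier G. y [^]\<^bsub>G\<^esub> (n::nat) = x" if "n > 0" "x \<in> carrier G" for n x
    using that
  proof (induction n arbitrary: x rule: less_induct)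
    case (less n)
    show ?case
    proof (cases "n = 1")
      case True
      then show ?thesis using less.prems by (intro bexI[of _ x]) auto
    next
      case False
      then obtain q m where q: "Factorial_Ring.prime q" "n = q * m"
        using prime_factor_nat by (metis dvdE)
      then have m: "m < n" "m > 0" using less.prems(1) prime_gt_1_nat[OF q(1)] by auto
      obtain y where y: "y \<in> carrier G" "y [^]\<^bsub>G\<^esub> m = x"
        using less.IH[OF m less.prems(2)] by blast
      obtain z where "z \<in> carrier G" "z [^]\<^bsub>G\<^esub> q = y" using p[OF q(1) y(1)] by blast
      then show ?thesis using y q(2) by (intro bexI[of _ z]) (auto simp flip: nat_pow_pow)
    qed
  qed
  then show ?thesis by (auto simp: divisible_group_def)
qed

text \<open>For the prime \<open>p\<close> itself, a complex \<open>p\<close>-th root again has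
  \<open>p\<close>-power order; every other prime is invertible modulo the powers of
  \<open>p\<close>.\<close>

lemma divisible_prufer_group:
  assumes p: "Factorial_Ring.prime p"
  shows "divisible_group (prufer_group p)"
proof (rule divisible_groupI_prime)
  show "group (prufer_group p)" using comm_group_prufer_group[OF p] by (rule comm_group.axioms(2))
  fix q :: nat and z assume q: "Factorial_Ring.prime q" and z: "z \<in> carrier (prufer_group p)"
  then obtain n where n: "z ^ (p ^ n) = 1" by (auto simp: prufer_group_def)
  have p0: "p > 0" using p by (rule prime_gt_0_nat)
  show "\<exists>y\<in>carrier (prufer_group p). y [^]\<^bsub>prufer_group p\<^esub> q = z"
  proof (cases "q = p")
    case True
    \<comment> \<open>A root of unity lies on the unit circle, so dividing its argument by
      \<open>p\<close> gives a \<open>p\<close>-th root, at the cost of raising the exponent from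
      \<open>n\<close> to \<open>Suc n\<close>.\<close>
    have "norm z ^ (p ^ n) = 1" using n by (metis norm_one norm_power)
    then have "norm z = 1" using p0 power_eq_1_iff by fastforce
    then have "cis (Arg z) = z"
      using cis_Arg[of z] by (cases "z = 0") (auto simp: sgn_eq)
    then have w: "cis (Arg z / p) ^ p = z"
      using p0 by (simp add: DeMoivre)
    then have "cis (Arg z / p) ^ (p ^ Suc n) = 1" using n by (simp add: power_mult)
    then have "cis (Arg z / p) \<in> carrier (prufer_group p)"
      unfolding prufer_group_def by (auto simp del: power_Suc)
    then show ?thesis
      using w True by (intro bexI[of _ "cis (Arg z / p)"]) (auto simp: nat_pow_prufer_group)
  next
    case False
    then have "coprime q (p ^ n)" using p q by (simp add: primes_coprime)
    \<comment> \<open>Bezout makes \<open>x\<close> an inverse of \<open>q\<close> modulo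
      \<open>p ^ n\<close>, which is an exponent killing \<open>z\<close>; hence
      \<open>z ^ x\<close> is a \<open>q\<close>-th root of \<open>z\<close>.\<close>
    then obtain x y where xy: "q * x = p ^ n * y + 1"
      using bezout_nat[of q "p ^ n"] q by (auto simp: coprime_iff_gcd_eq_1)
    have "(z ^ x) ^ q = z ^ (p ^ n * y + 1)" by (simp add: xy mult.commute flip: power_mult)
    also have "\<dots> = z" using n by (simp add: power_add power_mult)
    finally have 1: "(z ^ x) ^ q = z" .
    have "(z ^ x) ^ (p ^ n) = 1" using n by (metis mult.commute power_mult power_one)
    then have "z ^ x \<in> carrier (prufer_group p)" by (auto simp: prufer_group_def)
    then show ?thesis using 1 by (intro bexI[of _ "z ^ x"]) (auto simp: nat_pow_prufer_group)
  qed
qed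

lemma countable_prufer_group:
  assumes "Factorial_Ring.prime p"
  shows "countable (carrier (prufer_group p))"
proof -
  have "carrier (prufer_group p) = (\<Union>n. {z. z ^ (p ^ n) = 1})"
    by (auto simp: prufer_group_def)
  moreover have "countable {z :: complex. z ^ (p ^ n) = 1}" for n
    using assms by (intro countable_finite finite_roots_unity) (simp add: Suc_leI prime_gt_0_nat)
  ultimately show ?thesis by simp
qed

section \<open>Divisibility and cardinality of direct sums\<close>

lemma nat_pow_DirProd:
  assumes "group G" "group H" "x \<in> carrier G" "y \<in> carrier H"
  shows "(x, y) [^]\<^bsub>G \<times>\<times> H\<^esub> (n::nat) = (x [^]\<^bsub>G\<^esub> n, y [^]\<^bsub>H\<^esub> n)"
  using int_pow_DirProd[OF assms, of "int n"] by (simp add: int_pow_int)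

lemma nat_pow_sum_group:
  assumes F: "\<And>i. i \<in> I \<Longrightarrow> group (F i)" and x: "x \<in> carrier (sum_group I F)" and i: "i \<in> I"
  shows "(x [^]\<^bsub>sum_group I F\<^esub> (n::nat)) i = x i [^]\<^bsub>F i\<^esub> n"
proof (rule hom_nat_pow[where h = "\<lambda>x. x i"])
  show "(\<lambda>x. x i) \<in> hom (sum_group I F) (F i)"
    using i by (auto simp: hom_def carrier_sum_group F)
qed (use F x i in auto)

lemma divisible_DirProd:
  assumes "group G" "group H" "divisible_group G" "divisible_group H"
  shows "divisible_group (G \<times>\<times> H)"
  unfolding divisible_group_def
proof (intro allI impI ballI)
  fix n :: nat and x assume n: "0 < n" and x: "x \<in> carrier (G \<times>\<times> H)"
  have "fst x \<in> carrier G" "snd x \<in> carrier H" using x by auto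
  then obtain y z where "y \<in> carrier G" "y [^]\<^bsub>G\<^esub> n = fst x" "z \<in> carrier H" "z [^]\<^bsub>H\<^esub> n = snd x"
    using assms(3,4) n unfolding divisible_group_def by meson
  then show "\<exists>y\<in>carrier (G \<times>\<times> H). y [^]\<^bsub>G \<times>\<times> H\<^esub> n = x"
    using assms(1,2) by (intro bexI[of _ "(y, z)"]) (auto simp: nat_pow_DirProd)
qed

lemma divisible_sum_group:
  assumes F: "\<And>i. i \<in> I \<Longrightarrow> group (F i)" and div: "\<And>i. i \<in> I \<Longrightarrow> divisible_group (F i)"
  shows "divisible_group (sum_group I F)"
  unfolding divisible_group_def
proof (intro allI impI ballI)
  fix n :: nat and x assume n: "0 < n" and x: "x \<in> carrier (sum_group I F)"
  have xi: "x i \<in> carrier (F i)" if "i \<in> I" for i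
    using x that by (auto simp: carrier_sum_group F)
  \<comment> \<open>Roots are chosen coordinatewise. The last conjunct forces the root of a neutral
    coordinate to be neutral, so that the chosen family keeps finite support.\<close>
  have "\<exists>y. i \<in> I \<longrightarrow> y \<in> carrier (F i) \<and> y [^]\<^bsub>F i\<^esub> n = x i \<and> (x i = \<one>\<^bsub>F i\<^esub> \<longrightarrow> y = \<one>\<^bsub>F i\<^esub>)" for i
  proof (cases "i \<in> I \<and> x i \<noteq> \<one>\<^bsub>F i\<^esub>")
    case True
    then show ?thesis using div[of i] n xi[of i] unfolding divisible_group_def by blast
  next
    case False
    show ?thesis
      by (rule exI[of _ "\<one>\<^bsub>F i\<^esub>"]) (use False F[of i] in \<open>auto simp: group.is_monoid monoid.nat_pow_one\<close>)
  qed
  then obtain y where y: "\<And>i. i \<in> I \<Longrightarrow> y i \<in> carrier (F i)" "\<And>i. i \<in> I \<Longrightarrow> y i [^]\<^bsub>F i\<^esub> n = x i"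
    "\<And>i. i \<in> I \<Longrightarrow> x i = \<one>\<^bsub>F i\<^esub> \<Longrightarrow> y i = \<one>\<^bsub>F i\<^esub>" by metis
  let ?y = "restrict y I"
  have "finite {i \<in> I. y i \<noteq> \<one>\<^bsub>F i\<^esub>}"
    by (rule finite_subset[of _ "{i \<in> I. x i \<noteq> \<one>\<^bsub>F i\<^esub>}"])
      (use x y(3) in \<open>auto simp: carrier_sum_group F\<close>)
  then have yc: "?y \<in> carrier (sum_group I F)"
    using y(1) by (auto simp: carrier_sum_group F cong: conj_cong)
  have "?y [^]\<^bsub>sum_group I F\<^esub> n \<in> carrier (sum_group I F)"
    using yc F by (intro monoid.nat_pow_closed group.is_monoid sum_group)
  then have "?y [^]\<^bsub>sum_group I F\<^esub> n = x"
    using x y(2) nat_pow_sum_group[OF F yc]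
    by (intro ext) (auto simp: carrier_sum_group F PiE_iff extensional_def; metis)
  with yc show "\<exists>y\<in>carrier (sum_group I F). y [^]\<^bsub>sum_group I F\<^esub> n = x" by blast
qed

text \<open>An element is determined by its graph over its support, a finite subset of the disjoint
  union of the carriers. That union has size at most \<open>|B|\<close>, and an infinite set has as
  many finite subsets as elements.\<close>

lemma card_sum_group_ordLeq:
  assumes B: "infinite B" and I: "|I| \<le>o |B|" and F: "\<And>i. i \<in> I \<Longrightarrow> group (F i)"
    and card: "\<And>i. i \<in> I \<Longrightarrow> |carrier (F i)| \<le>o |B|"
  shows "|carrier (sum_group I F)| \<le>o |B|"
proof -
  let ?S = "SIGMA i:I. carrier (F i)"
  let ?g = "\<lambda>x. (\<lambda>i. (i, x i)) ` {i \<in> I. x i \<noteq> \<one>\<^bsub>F i\<^esub>}"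
  have "inj_on ?g (carrier (sum_group I F))"
  proof (rule inj_onI)
    fix x y assume xy: "x \<in> carrier (sum_group I F)" "y \<in> carrier (sum_group I F)" "?g x = ?g y"
    have mem: "(i, v) \<in> ?g z \<longleftrightarrow> i \<in> I \<and> v = z i \<and> z i \<noteq> \<one>\<^bsub>F i\<^esub>" for i v z by auto
    have "x i = y i" if "i \<in> I" for i
      using mem[of i "x i" x] mem[of i "y i" y] mem[of i "x i" y] mem[of i "y i" x] xy(3) that
      by metis
    then show "x = y" using xy(1,2) by (auto simp: carrier_sum_group F intro: PiE_ext)
  qed
  moreover have "?g ` carrier (sum_group I F) \<subseteq> Fpow ?S"
    by (auto simp: Fpow_def carrier_sum_group F)
  ultimately have "|carrier (sum_group I F)| \<le>o |Fpow ?S|"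
    using card_of_ordLeq by blast
  also have "|Fpow ?S| \<le>o |Fpow B|"
    by (intro card_of_Fpow_mono card_of_Sigma_ordLeq_infinite[OF B I]) (use card in blast)
  also have "|Fpow B| =o |B|" using B by (rule card_of_Fpow_infinite)
  finally show ?thesis .
qed

lemma card_countable_ordLeq:
  assumes "infinite B" "countable A"
  shows "|A| \<le>o |B|"
proof -
  have "|A| \<le>o |UNIV :: nat set|"
    using assms(2) by (metis card_of_ordLeq countableE top_greatest)
  also have "|UNIV :: nat set| \<le>o |B|" using assms(1) by (simp add: infinite_iff_card_of_nat)
  finally show ?thesis .
qed

section \<open>The group \<open>U\<close> and the orders of its elements\<close>

text \<open>The sum of the Prufer groups is a copy of the rationals modulo the integers, the usual
  cogenerator of abelian groups. The summand \<open>rat_group\<close> adds elements of infinite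
  order, so that embeddings can be made into direct sums instead of products.\<close>

definition cogen_group :: "(rat \<times> (nat \<Rightarrow> complex)) monoid" where
  "cogen_group = rat_group \<times>\<times> sum_group {p. Factorial_Ring.prime p} prufer_group"

lemma group_rat_group: "group rat_group"
  using comm_group_rat_group by (rule comm_group.axioms(2))

lemma group_prufer_group: "Factorial_Ring.prime p \<Longrightarrow> group (prufer_group p)"
  using comm_group_prufer_group by (rule comm_group.axioms(2))

lemma group_sum_prufer_group: "group (sum_group {p. Factorial_Ring.prime p} prufer_group)"
  by (intro sum_group) (simp add: group_prufer_group)

lemma comm_group_cogen_group: "comm_group cogen_group"
  unfolding cogen_group_def
  by (intro comm_group_DirProd comm_group_sum_group comm_group_rat_group)
    (auto intro: comm_group_prufer_group)

lemma divisible_cogen_group: "divisible_group cogen_group"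
  unfolding cogen_group_def
  by (intro divisible_DirProd divisible_sum_group divisible_rat_group group_sum_prufer_group)
    (auto intro: group_rat_group group_prufer_group divisible_prufer_group)

lemma card_cogen_group_ordLeq:
  assumes B: "infinite B"
  shows "|carrier cogen_group| \<le>o |B|"
  unfolding cogen_group_def carrier_DirProd
proof (rule card_of_Times_ordLeq_infinite[OF B])
  show "|carrier rat_group| \<le>o |B|" using B by (intro card_countable_ordLeq) auto
  show "|carrier (sum_group {p. Factorial_Ring.prime p} prufer_group)| \<le>o |B|"
    by (intro card_sum_group_ordLeq B card_countable_ordLeq)
      (auto intro: group_prufer_group countable_prufer_group)
qed

lemma (in group) ord_eq_prime:
  assumes "x \<in> carrier G" "Factorial_Ring.prime p" "x [^] p = \<one>" "x \<noteq> \<one>"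
  shows "ord x = p"
  using assms pow_eq_id[of x p] ord_eq_1[of x] by (auto simp: prime_nat_iff)

text \<open>Order \<open>0\<close> stands for infinite order and is realised by the rational
  \<open>1\<close>. A prime order is realised by a nontrivial root of unity placed in the coordinate
  of that prime.\<close>

lemma ex_ord_cogen_group:
  assumes "n = 0 \<or> Factorial_Ring.prime n"
  shows "\<exists>u\<in>carrier cogen_group. group.ord cogen_group u = n"
proof -
  let ?S = "sum_group {p. Factorial_Ring.prime p} prufer_group"
  interpret U: comm_group cogen_group by (rule comm_group_cogen_group)
  interpret S: group ?S by (rule group_sum_prufer_group)
  have carrS: "carrier ?S = {x \<in> \<Pi>\<^sub>E q\<in>{p. Factorial_Ring.prime p}. carrier (prufer_group q).
      finite {q \<in> {p. Factorial_Ring.prime p}. x q \<noteq> \<one>\<^bsub>prufer_group q\<^esub>}}"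
    by (rule carrier_sum_group) (simp add: group_prufer_group)
  show ?thesis
  proof (cases "n = 0")
    case True
    let ?u = "(1::rat, \<one>\<^bsub>?S\<^esub>)"
    have u: "?u \<in> carrier cogen_group"
      unfolding cogen_group_def carrier_DirProd using S.one_closed by (auto simp: rat_group_def)
    have "?u [^]\<^bsub>cogen_group\<^esub> k = (of_nat k, \<one>\<^bsub>?S\<^esub>)" for k :: nat
      unfolding cogen_group_def
      by (subst nat_pow_DirProd)
        (auto simp del: one_sum_group simp: group_rat_group S.is_group nat_pow_rat_group,
          simp add: rat_group_def)
    then have "group.ord cogen_group ?u = 0"
      unfolding U.ord_eq_0[OF u] by (auto simp: cogen_group_def, auto simp: rat_group_def)
    with u True show ?thesis by blast
  next
    case False
    with assms have p: "Factorial_Ring.prime n" by simp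
    then have n2: "n \<ge> 2" by (rule prime_ge_2_nat)
    \<comment> \<open>There are exactly \<open>n\<close> complex \<open>n\<close>-th roots of unity
      and \<open>n\<close> is at least two, so one of them differs from \<open>1\<close>.\<close>
    have "\<exists>z::complex. z ^ n = 1 \<and> z \<noteq> 1"
    proof (rule ccontr)
      assume "\<not> ?thesis"
      then have "{z::complex. z ^ n = 1} \<subseteq> {1}" by auto
      then have "card {z::complex. z ^ n = 1} \<le> 1"
        by (metis card.empty card_insert_le_m1 card_mono finite.emptyI finite.insertI
            is_singletonI is_singleton_altdef)
      then show False using card_roots_unity_eq[of n] n2 by simp
    qed
    then obtain z :: complex where z: "z ^ n = 1" "z \<noteq> 1" by blast
    let ?x = "\<lambda>q\<in>{p. Factorial_Ring.prime p}. if q = n then z else 1"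
    let ?u = "(0::rat, ?x)"
    have "z ^ (n ^ 1) = 1" using z by simp
    then have zc: "z \<in> carrier (prufer_group n)"
      unfolding prufer_group_def partial_object.select_convs by (intro CollectI exI)
    have one: "\<one>\<^bsub>prufer_group q\<^esub> = 1" for q by (simp add: prufer_group_def)
    have "finite {q \<in> {p. Factorial_Ring.prime p}. ?x q \<noteq> \<one>\<^bsub>prufer_group q\<^esub>}"
      by (rule finite_subset[of _ "{n}"]) (auto simp: one)
    moreover have "(if q = n then z else 1) \<in> carrier (prufer_group q)" for q
      using zc by (auto simp: prufer_group_def)
    ultimately have x: "?x \<in> carrier ?S"
      unfolding carrS by auto
    then have u: "?u \<in> carrier cogen_group"
      unfolding cogen_group_def by (auto simp: rat_group_def)
    have "(?x [^]\<^bsub>?S\<^esub> n) q = \<one>\<^bsub>?S\<^esub> q" for q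
    proof (cases "Factorial_Ring.prime q")
      case True
      then show ?thesis
        using nat_pow_sum_group[OF _ x, of q n] z
        by (auto simp: group_prufer_group nat_pow_prufer_group) (auto simp: prufer_group_def)
    next
      case False
      then show ?thesis
        using S.nat_pow_closed[OF x, of n] unfolding carrS PiE_iff extensional_def by simp
    qed
    then have "?x [^]\<^bsub>?S\<^esub> n = \<one>\<^bsub>?S\<^esub>" by (rule ext)
    then have "?u [^]\<^bsub>cogen_group\<^esub> n = \<one>\<^bsub>cogen_group\<^esub>"
      unfolding cogen_group_def using x
      by (subst nat_pow_DirProd)
        (auto simp del: one_sum_group simp: group_rat_group S.is_group nat_pow_rat_group,
          auto simp: rat_group_def)
    moreover have "?u \<noteq> \<one>\<^bsub>cogen_group\<^esub>"
    proof
      assume "?u = \<one>\<^bsub>cogen_group\<^esub>"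
      then have "?x n = \<one>\<^bsub>?S\<^esub> n" by (simp add: cogen_group_def)
      then show False using z p by (simp add: prufer_group_def)
    qed
    ultimately show ?thesis using U.ord_eq_prime[OF u p] u by blast
  qed
qed

section \<open>Embedding abelian groups into direct sums\<close>

text \<open>If the order is finite, it is not one, so it factors as \<open>p * k\<close> with
  \<open>p\<close> prime, and the \<open>k\<close>-th power has order \<open>p\<close>. In the
  infinite case \<open>k = 1\<close> works.\<close>

lemma (in group) ex_pow_ord_0_or_prime:
  assumes "a \<in> carrier G" "a \<noteq> \<one>"
  shows "\<exists>k::nat. ord (a [^] k) = 0 \<or> Factorial_Ring.prime (ord (a [^] k))"
proof (cases "ord a = 0")
  case True
  then show ?thesis using assms by (intro exI[of _ 1]) auto
next
  case False
  have "ord a \<noteq> 1" using assms ord_eq_1 by blast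
  then obtain p k where p: "Factorial_Ring.prime p" "ord a = p * k"
    using prime_factor_nat by (metis dvdE)
  then have "ord (a [^] k) = p"
    using assms False by (subst ord_pow) auto
  with p show ?thesis by blast
qed

text \<open>
  Among the injective partial homomorphisms (as graphs \<open>R\<close>) whose values are supported on
  \<open>\<iota>\<close> of their domain, a maximal one has essential domain: an element \<open>b\<close> of infinite or prime
  order whose powers meet the domain trivially could be sent to the fresh coordinate \<open>\<iota> b\<close>.
  Any extension of it to \<open>A\<close> is then injective.
\<close>

theorem ex_mon_sum_group:
  assumes A: "comm_group A" and U: "comm_group U" and div: "divisible_group U"
    and ords: "\<And>n. n = 0 \<or> Factorial_Ring.prime n \<Longrightarrow> \<exists>u\<in>carrier U. group.ord U u = n"
    and \<iota>: "inj_on \<iota> (carrier A)" "\<iota> ` carrier A \<subseteq> I"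
  shows "\<exists>f. f \<in> mon A (sum_group I (\<lambda>_. U))"
proof -
  define D where "D = sum_group I (\<lambda>_. U)"
  interpret A: comm_group A by fact
  interpret U: comm_group U by fact
  have D: "comm_group D" unfolding D_def using U by (intro comm_group_sum_group)
  have divD: "divisible_group D" unfolding D_def using div by (intro divisible_sum_group U.is_group)
  interpret D: comm_group D by fact
  interpret P: comm_group "A \<times>\<times> D" using A D by (rule comm_group_DirProd)
  have Dcarr: "carrier D = {x \<in> I \<rightarrow>\<^sub>E carrier U. finite {i \<in> I. x i \<noteq> \<one>\<^bsub>U\<^esub>}}"
    unfolding D_def by (simp add: carrier_sum_group U.is_group)
  have Dmult: "(x \<otimes>\<^bsub>D\<^esub> y) i = x i \<otimes>\<^bsub>U\<^esub> y i" and Done: "\<one>\<^bsub>D\<^esub> i = \<one>\<^bsub>U\<^esub>" if "i \<in> I" for x y i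
    using that by (auto simp: D_def)
  \<comment> \<open>The equivalence encodes single-valuedness in one direction and injectivity in
    the other. The support condition keeps the coordinates outside the image of the domain free for
    later extension steps.\<close>
  define \<A> where "\<A> = {R. subgroup R (A \<times>\<times> D) \<and> (\<forall>(a, d)\<in>R. a = \<one>\<^bsub>A\<^esub> \<longleftrightarrow> d = \<one>\<^bsub>D\<^esub>)
      \<and> (\<forall>(a, d)\<in>R. \<forall>i\<in>I. d i \<noteq> \<one>\<^bsub>U\<^esub> \<longrightarrow> i \<in> \<iota> ` fst ` R)}"
  have in_\<A>: "R \<in> \<A>" if R: "subgroup R (A \<times>\<times> D)"
    and R': "\<And>a d. (a, d) \<in> R \<Longrightarrow>
      (a = \<one>\<^bsub>A\<^esub> \<longleftrightarrow> d = \<one>\<^bsub>D\<^esub>) \<and> (\<forall>i\<in>I. d i \<noteq> \<one>\<^bsub>U\<^esub> \<longrightarrow> i \<in> \<iota> ` fst ` R)" for R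
    unfolding \<A>_def mem_Collect_eq
    by (intro conjI R ballI; simp only: split_paired_all prod.case; drule R'; elim conjE; assumption)
  have "\<exists>M\<in>\<A>. \<forall>R\<in>\<A>. M \<subseteq> R \<longrightarrow> R = M"
  proof (rule subset_Zorn_nonempty)
    have "{\<one>\<^bsub>A \<times>\<times> D\<^esub>} \<in> \<A>"
      using P.triv_subgroup by (auto simp: \<A>_def Done)
    then show "\<A> \<noteq> {}" by blast
    fix \<C> assume \<C>: "\<C> \<noteq> {}" "subset.chain \<A> \<C>"
    have "subgroup (\<Union>\<C>) (A \<times>\<times> D)"
    proof (rule subgroup_Union_chain)
      show "H \<subseteq> K \<or> K \<subseteq> H" if "H \<in> \<C>" "K \<in> \<C>" for H K
        using \<C>(2) that unfolding subset.chain_def by blast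
    qed (use \<C> in \<open>auto simp: subset.chain_def \<A>_def P.is_group\<close>)
    moreover have "(a = \<one>\<^bsub>A\<^esub> \<longleftrightarrow> d = \<one>\<^bsub>D\<^esub>) \<and> (\<forall>i\<in>I. d i \<noteq> \<one>\<^bsub>U\<^esub> \<longrightarrow> i \<in> \<iota> ` fst ` \<Union>\<C>)"
      if ad: "(a, d) \<in> \<Union>\<C>" for a d
    proof -
      obtain R where R: "R \<in> \<C>" "(a, d) \<in> R" using ad by blast
      then have "R \<in> \<A>" using \<C>(2) by (auto simp: subset.chain_def)
      then have "(a = \<one>\<^bsub>A\<^esub> \<longleftrightarrow> d = \<one>\<^bsub>D\<^esub>) \<and> (\<forall>i\<in>I. d i \<noteq> \<one>\<^bsub>U\<^esub> \<longrightarrow> i \<in> \<iota> ` fst ` R)"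
        using R(2) by (auto simp: \<A>_def)
      moreover have "\<iota> ` fst ` R \<subseteq> \<iota> ` fst ` \<Union>\<C>" using R(1) by (intro image_mono Union_upper)
      ultimately show ?thesis by (meson subsetD)
    qed
    ultimately show "\<Union>\<C> \<in> \<A>" by (rule in_\<A>)
  qed
  then obtain M where MA: "M \<in> \<A>" and max: "\<And>R. R \<in> \<A> \<Longrightarrow> M \<subseteq> R \<Longrightarrow> R = M"
    by metis
  have M: "subgroup M (A \<times>\<times> D)" "\<And>a d. (a, d) \<in> M \<Longrightarrow> a = \<one>\<^bsub>A\<^esub> \<longleftrightarrow> d = \<one>\<^bsub>D\<^esub>"
    "\<And>a d i. (a, d) \<in> M \<Longrightarrow> i \<in> I \<Longrightarrow> d i \<noteq> \<one>\<^bsub>U\<^esub> \<Longrightarrow> i \<in> \<iota> ` fst ` M"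
    using MA by (auto simp: \<A>_def)
  interpret M: subgroup M "A \<times>\<times> D" by (rule M)
  have carr: "a \<in> carrier A" "d \<in> carrier D" if "(a, d) \<in> M" for a d
    using M.mem_carrier[OF that] by auto
  have "group_hom (A \<times>\<times> D) A fst"
    by (auto simp: group_hom_def group_hom_axioms_def hom_def P.is_group A.is_group)
  then have H: "subgroup (fst ` M) A" by (rule group_hom.subgroup_img_is_subgroup) (rule M)
  have essential: "\<exists>n::int. a [^]\<^bsub>A\<^esub> n \<in> fst ` M \<and> a [^]\<^bsub>A\<^esub> n \<noteq> \<one>\<^bsub>A\<^esub>"
    if a: "a \<in> carrier A" "a \<noteq> \<one>\<^bsub>A\<^esub>" for a
  proof (rule ccontr)
    assume "\<not> ?thesis"
    then have trivial: "a [^]\<^bsub>A\<^esub> n = \<one>\<^bsub>A\<^esub>" if "a [^]\<^bsub>A\<^esub> n \<in> fst ` M" for n :: int using that by blast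
    obtain k :: nat where k: "A.ord (a [^]\<^bsub>A\<^esub> k) = 0 \<or> Factorial_Ring.prime (A.ord (a [^]\<^bsub>A\<^esub> k))"
      using A.ex_pow_ord_0_or_prime[OF a] by blast
    define b where "b = a [^]\<^bsub>A\<^esub> k"
    have b: "b \<in> carrier A" using a by (simp add: b_def)
    have btriv: "b [^]\<^bsub>A\<^esub> n = \<one>\<^bsub>A\<^esub>" if "b [^]\<^bsub>A\<^esub> n \<in> fst ` M" for n :: int
    proof -
      have "b [^]\<^bsub>A\<^esub> n = a [^]\<^bsub>A\<^esub> (int k * n)"
        using a by (simp add: b_def A.int_pow_pow flip: int_pow_int)
      then show ?thesis using trivial that by simp
    qed
    have b1: "b \<noteq> \<one>\<^bsub>A\<^esub>"
      using k A.ord_eq_1[OF b] by (auto simp: b_def)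
    then have bH: "b \<notin> fst ` M" using btriv[of 1] b by auto
    \<comment> \<open>Equal orders make the assignment of powers of \<open>u\<close> to powers of
      \<open>b\<close> both well defined and injective.\<close>
    obtain u where u: "u \<in> carrier U" "U.ord u = A.ord b"
      using ords[of "A.ord b"] k by (auto simp: b_def)
    have ub: "u [^]\<^bsub>U\<^esub> n = \<one>\<^bsub>U\<^esub> \<longleftrightarrow> b [^]\<^bsub>A\<^esub> n = \<one>\<^bsub>A\<^esub>" for n :: int
      using u b by (simp add: U.int_pow_eq_id A.int_pow_eq_id)
    have \<iota>b: "\<iota> b \<in> I" "\<iota> b \<notin> \<iota> ` fst ` M"
      using \<iota> b bH inj_on_image_mem_iff[OF \<iota>(1) b subgroup.subset[OF H]] by blast+
    define s where "s v = (\<lambda>i\<in>I. if i = \<iota> b then v else \<one>\<^bsub>U\<^esub>)" for v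
    have sD: "s v \<in> carrier D" if "v \<in> carrier U" for v
    proof -
      have "finite {i \<in> I. s v i \<noteq> \<one>\<^bsub>U\<^esub>}"
        by (rule finite_subset[of _ "{\<iota> b}"]) (auto simp: s_def)
      then show ?thesis using that by (auto simp: Dcarr s_def)
    qed
    have "s \<in> hom U D"
      by (rule homI) (auto simp: sD, auto simp: s_def D_def fun_eq_iff)
    then have s_pow: "s u [^]\<^bsub>D\<^esub> n = s (u [^]\<^bsub>U\<^esub> n)" for n :: int
      using u by (simp add: hom_int_pow U.is_group D.is_group)
    have s1: "s \<one>\<^bsub>U\<^esub> = \<one>\<^bsub>D\<^esub>" by (auto simp: s_def D_def)
    let ?R = "adjoin (A \<times>\<times> D) M (b, s u)"
    have bs: "(b, s u) \<in> carrier (A \<times>\<times> D)" using b u sD by simp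
    note adj = subgroup_adjoin[OF P.comm_group_axioms M(1) bs] adjoin_superset[OF P.comm_group_axioms M(1) bs]
      mem_adjoin[OF P.comm_group_axioms M(1) bs]
    have "(c = \<one>\<^bsub>A\<^esub> \<longleftrightarrow> e = \<one>\<^bsub>D\<^esub>) \<and> (\<forall>i\<in>I. e i \<noteq> \<one>\<^bsub>U\<^esub> \<longrightarrow> i \<in> \<iota> ` fst ` ?R)"
      if ce: "(c, e) \<in> ?R" for c e
    proof -
      obtain x d n where xd: "(x, d) \<in> M" "c = x \<otimes>\<^bsub>A\<^esub> b [^]\<^bsub>A\<^esub> (n::int)" "e = d \<otimes>\<^bsub>D\<^esub> s (u [^]\<^bsub>U\<^esub> n)"
        using ce b u sD by (auto simp: adjoin_def int_pow_DirProd A.is_group D.is_group s_pow)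
      note xd_carr = carr[OF xd(1)]
      have sun: "s (u [^]\<^bsub>U\<^esub> n) \<in> carrier D" using u sD by simp
      have "e = \<one>\<^bsub>D\<^esub>" if "c = \<one>\<^bsub>A\<^esub>"
      proof -
        have "inv\<^bsub>A\<^esub> x = b [^]\<^bsub>A\<^esub> n"
          using xd that b xd_carr by (metis A.inv_equality A.int_pow_closed A.m_comm)
        then have "b [^]\<^bsub>A\<^esub> n \<in> fst ` M"
          using subgroup.m_inv_closed[OF H, of x] xd(1) by force
        then have bn: "b [^]\<^bsub>A\<^esub> n = \<one>\<^bsub>A\<^esub>" by (rule btriv)
        then have "x = \<one>\<^bsub>A\<^esub>" using xd(2) that xd_carr by simp
        then have "d = \<one>\<^bsub>D\<^esub>" using M(2)[OF xd(1)] by simp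
        moreover have "s (u [^]\<^bsub>U\<^esub> n) = \<one>\<^bsub>D\<^esub>" using iffD2[OF ub bn] s1 by simp
        ultimately show ?thesis using xd(3) by simp
      qed
      moreover have "c = \<one>\<^bsub>A\<^esub>" if "e = \<one>\<^bsub>D\<^esub>"
      proof -
        \<comment> \<open>Since \<open>d\<close> vanishes at the fresh coordinate, the value of
          \<open>e\<close> there is exactly the power of \<open>u\<close>; a trivial
          \<open>e\<close> therefore forces this power, and then \<open>d\<close>, to be
          trivial.\<close>
        have "d (\<iota> b) = \<one>\<^bsub>U\<^esub>" using M(3)[OF xd(1) \<iota>b(1)] \<iota>b(2) by blast
        moreover have "e (\<iota> b) = d (\<iota> b) \<otimes>\<^bsub>U\<^esub> u [^]\<^bsub>U\<^esub> n"
          using xd(3) \<iota>b(1) by (simp add: Dmult s_def)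
        ultimately have un: "u [^]\<^bsub>U\<^esub> n = \<one>\<^bsub>U\<^esub>" using that \<iota>b(1) u by (simp add: Done)
        then have "d = \<one>\<^bsub>D\<^esub>" using xd(3) that s1 xd_carr by simp
        then have "x = \<one>\<^bsub>A\<^esub>" using M(2)[OF xd(1)] by simp
        then show ?thesis using xd(2) iffD1[OF ub un] by simp
      qed
      moreover have "i \<in> \<iota> ` fst ` ?R" if i: "i \<in> I" "e i \<noteq> \<one>\<^bsub>U\<^esub>" for i
      proof (cases "i = \<iota> b")
        case True
        then show ?thesis using adj(3) by force
      next
        case False
        have di: "d i \<in> carrier U" using xd_carr(2) i(1) by (auto simp: Dcarr)
        have "e i = d i \<otimes>\<^bsub>U\<^esub> \<one>\<^bsub>U\<^esub>" using xd(3) i(1) False by (simp add: Dmult s_def)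
        then have "d i \<noteq> \<one>\<^bsub>U\<^esub>" using i(2) di by simp
        then have "i \<in> \<iota> ` fst ` M" by (rule M(3)[OF xd(1) i(1)])
        then show ?thesis using image_mono[OF image_mono[OF adj(2)]] by (rule subsetD[rotated])
      qed
      ultimately show ?thesis by (intro conjI iffI ballI impI)
    qed
    then have "?R \<in> \<A>" by (rule in_\<A>[OF adj(1)])
    then have "?R = M" using adj(2) by (rule max)
    then show False using adj(3) bH by force
  qed
  have "d = \<one>\<^bsub>D\<^esub>" if "(\<one>\<^bsub>A\<^esub>, d) \<in> M" for d using M(2)[OF that] by simp
  from Baer_extension[OF A D divD M(1) this]
  obtain g where g: "g \<in> hom A D" "\<And>a d. (a, d) \<in> M \<Longrightarrow> g a = d" by auto
  interpret g: group_hom A D g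
    using g(1) by (simp add: group_hom_def group_hom_axioms_def A.is_group D.is_group)
  \<comment> \<open>A nontrivial kernel element would have a nontrivial power in the domain of
    \<open>M\<close>, where \<open>g\<close> agrees with an injective map.\<close>
  have "a = \<one>\<^bsub>A\<^esub>" if a: "a \<in> carrier A" "g a = \<one>\<^bsub>D\<^esub>" for a
  proof (rule ccontr)
    assume "a \<noteq> \<one>\<^bsub>A\<^esub>"
    then obtain n :: int where n: "a [^]\<^bsub>A\<^esub> n \<in> fst ` M" "a [^]\<^bsub>A\<^esub> n \<noteq> \<one>\<^bsub>A\<^esub>"
      using essential[OF a(1)] by blast
    then obtain d where d: "(a [^]\<^bsub>A\<^esub> n, d) \<in> M" by auto
    have "d = g (a [^]\<^bsub>A\<^esub> n)" using g(2)[OF d] by simp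
    also have "\<dots> = \<one>\<^bsub>D\<^esub>" using a by (simp add: g.hom_int_pow)
    finally show False using M(2)[OF d] n(2) by simp
  qed
  then have "g \<in> mon A D"
    using g(1) by (auto simp: mon_def g.inj_on_one_iff)
  then show ?thesis unfolding D_def by blast
qed

section \<open>The swindle for mutually embedded divisible groups\<close>

text \<open>
  Eilenberg--Pelczynski swindle: with \<open>G \<cong> W \<oplus> R\<close>, \<open>W \<cong> G \<oplus> R'\<close> and \<open>W \<cong> W\<^sup>(\<^sup>\<omega>\<^sup>)\<close> one gets
  \<open>W \<cong> G\<^sup>(\<^sup>\<omega>\<^sup>) \<oplus> R'\<^sup>(\<^sup>\<omega>\<^sup>) \<cong> G \<oplus> W \<cong> (W \<oplus> W) \<oplus> R \<cong> W \<oplus> R \<cong> G\<close>.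
\<close>

theorem iso_sum_group_of_mutual_embedding:
  fixes G :: "'a monoid" and U :: "'u monoid" and I :: "'i set"
  defines "W \<equiv> sum_group I (\<lambda>_. U)"
  assumes G: "comm_group G" "divisible_group G" and U: "comm_group U" "divisible_group U"
    and I: "infinite I" and e: "e \<in> mon G W" and f: "f \<in> mon W G"
  shows "G \<cong> W"
proof -
  let ?N = "UNIV :: nat set"
  have gU: "group U" using U(1) by (rule comm_group.axioms(2))
  have gG: "group G" using G(1) by (rule comm_group.axioms(2))
  have W: "comm_group W" unfolding W_def using U(1) by (intro comm_group_sum_group)
  then have gW: "group W" by (rule comm_group.axioms(2))
  have divW: "divisible_group W" unfolding W_def using U(2) gU by (intro divisible_sum_group)
  obtain R :: "'a monoid" where R: "group R" "G \<cong> W \<times>\<times> R"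
    using divisible_subgroup_splits[OF G(1) W divW f] by blast
  obtain R' :: "('i \<Rightarrow> 'u) monoid" where R': "group R'" "W \<cong> G \<times>\<times> R'"
    using divisible_subgroup_splits[OF W G e] by blast
  note gs = gG gW R(1) R'(1) DirProd_group sum_group
  have absorb: "sum_group ?N (\<lambda>_. W) \<cong> W"
    unfolding W_def by (rule sum_group_nat_absorb[OF I gU])
  have absorb': "W \<cong> sum_group ?N (\<lambda>_. W)"
    by (rule group.iso_sym[OF _ absorb]) (simp add: gW)
  have W_nat: "W \<cong> sum_group ?N (\<lambda>_. G) \<times>\<times> sum_group ?N (\<lambda>_. R')"
  proof -
    note absorb'
    also have "sum_group ?N (\<lambda>_. W) \<cong> sum_group ?N (\<lambda>_. G \<times>\<times> R')"
      by (rule iso_sum_groupI) (auto intro: gs R'(2))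
    also have "\<dots> \<cong> sum_group ?N (\<lambda>_. G) \<times>\<times> sum_group ?N (\<lambda>_. R')"
      by (rule sum_group_DirProd) (auto intro: gs)
    finally show ?thesis .
  qed
  have WW: "W \<cong> W \<times>\<times> W"
  proof -
    note absorb'
    also have "sum_group ?N (\<lambda>_. W) \<cong> W \<times>\<times> sum_group ?N (\<lambda>_. W)"
      by (rule sum_group_nat_split[OF gW])
    also have "\<dots> \<cong> W \<times>\<times> W"
      by (rule DirProd_iso_cong[OF iso_refl absorb gW])
    finally show ?thesis .
  qed
  have "W \<cong> sum_group ?N (\<lambda>_. G) \<times>\<times> sum_group ?N (\<lambda>_. R')" by (rule W_nat)
  also have "\<dots> \<cong> (G \<times>\<times> sum_group ?N (\<lambda>_. G)) \<times>\<times> sum_group ?N (\<lambda>_. R')"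
    by (rule DirProd_iso_cong[OF sum_group_nat_split[OF gG] iso_refl]) (auto intro: gs)
  also have "\<dots> \<cong> G \<times>\<times> (sum_group ?N (\<lambda>_. G) \<times>\<times> sum_group ?N (\<lambda>_. R'))"
    by (rule DirProd_assoc_iso)
  also have "\<dots> \<cong> G \<times>\<times> W"
    by (rule DirProd_iso_cong[OF iso_refl group.iso_sym[OF gW W_nat] gG])
  also have "\<dots> \<cong> W \<times>\<times> G" by (rule DirProd_commute_iso)
  also have "\<dots> \<cong> W \<times>\<times> (W \<times>\<times> R)" by (rule DirProd_iso_cong[OF iso_refl R(2) gW])
  also have "\<dots> \<cong> (W \<times>\<times> W) \<times>\<times> R"
    by (rule group.iso_sym[OF _ DirProd_assoc_iso]) (auto intro: gs)
  also have "\<dots> \<cong> W \<times>\<times> R"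
    by (rule DirProd_iso_cong[OF group.iso_sym[OF gW WW] iso_refl]) (auto intro: gs)
  also have "\<dots> \<cong> G" by (rule group.iso_sym[OF gG R(2)])
  finally show ?thesis by (rule group.iso_sym[OF gW])
qed

section \<open>The structure of limit models\<close>

text \<open>Bridges the sum of copies of \<open>U\<close>, which suits the swindle, and the form in
  the theorem: the outer sum is distributed over the product and then exchanged with the sum over
  primes.\<close>

lemma sum_cogen_group_iso:
  "sum_group I (\<lambda>_. cogen_group) \<cong> sum_group I (\<lambda>_. rat_group) \<times>\<times>
     sum_group {p. Factorial_Ring.prime p} (\<lambda>p. sum_group I (\<lambda>_. prufer_group p))"
proof -
  have "sum_group I (\<lambda>_. cogen_group) \<cong>
      sum_group I (\<lambda>_. rat_group) \<times>\<times> sum_group I (\<lambda>_. sum_group {p. Factorial_Ring.prime p} prufer_group)"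
    unfolding cogen_group_def
    by (rule sum_group_DirProd) (rule group_rat_group, rule group_sum_prufer_group)
  also have "\<dots> \<cong> sum_group I (\<lambda>_. rat_group) \<times>\<times>
      sum_group {p. Factorial_Ring.prime p} (\<lambda>p. sum_group I (\<lambda>_. prufer_group p))"
  proof (rule DirProd_iso_cong[OF iso_refl])
    show "sum_group I (\<lambda>_. sum_group {p. Factorial_Ring.prime p} prufer_group)
        \<cong> sum_group {p. Factorial_Ring.prime p} (\<lambda>p. sum_group I (\<lambda>_. prufer_group p))"
      using sum_group_swap[of I "{p. Factorial_Ring.prime p}" "\<lambda>_ p. prufer_group p"] group_prufer_group
      by simp
  qed (simp add: group_rat_group)
  finally show ?thesis .
qed

theorem theorem3p7:
  fixes \<kappa> :: "'k rel" and \<alpha> :: "'o rel" and G :: "'a monoid"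
  assumes "Cinfinite \<kappa>"
    and "Well_order \<alpha>" and "\<alpha> <o cardSuc \<kappa>"
    and "Field \<alpha> \<noteq> {}" and "wo_rel.isLimOrd \<alpha>"
    and "limit_model \<kappa> \<alpha> G"
  shows "G \<cong> sum_group (Field \<kappa>) (\<lambda>_. rat_group) \<times>\<times>
             sum_group {p. Factorial_Ring.prime p} (\<lambda>p. sum_group (Field \<kappa>) (\<lambda>_. prufer_group p))"
proof -
  obtain C :: "'o \<Rightarrow> 'a monoid" where
    "\<forall>i\<in>Field \<alpha>. comm_group (C i) \<and> |carrier (C i)| =o \<kappa>"
    "\<forall>i\<in>Field \<alpha>. universal_over \<kappa> (C i) (C (wo_rel.succ \<alpha> i))"
    "\<forall>i\<in>Field \<alpha>. ab_subgroup (C i) G"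
    and un: "carrier G = (\<Union>i\<in>Field \<alpha>. carrier (C i))"
    using assms(6) unfolding limit_model_def by (elim exE conjE) (rule that; assumption)
  then have C: "\<And>i. i \<in> Field \<alpha> \<Longrightarrow> comm_group (C i)" "\<And>i. i \<in> Field \<alpha> \<Longrightarrow> |carrier (C i)| =o \<kappa>"
    and univ: "\<And>i. i \<in> Field \<alpha> \<Longrightarrow> universal_over \<kappa> (C i) (C (wo_rel.succ \<alpha> i))"
    and sub: "\<And>i. i \<in> Field \<alpha> \<Longrightarrow> ab_subgroup (C i) G"
    by simp_all
  let ?W = "sum_group (Field \<kappa>) (\<lambda>_. cogen_group)"
  have inf: "infinite (Field \<kappa>)" and Card: "Card_order \<kappa>"
    using assms(1) by (auto simp: cinfinite_def)
  have F\<kappa>: "|Field \<kappa>| =o \<kappa>" using Card by (rule card_of_Field_ordIso)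
  have wo: "wo_rel \<alpha>" using assms(2) by (simp add: wo_rel_def)
  \<comment> \<open>The index is a limit ordinal, so no element is last and every stage has a
    universal extension inside the chain.\<close>
  have succ: "wo_rel.succ \<alpha> i \<in> Field \<alpha>" if "i \<in> Field \<alpha>" for i
    using wo_rel.succ_in_Field[OF wo] wo_rel.isLimOrd_aboveS[OF wo assms(5) that] by blast
  have gU: "group cogen_group" using comm_group_cogen_group by (rule comm_group.axioms(2))
  have W: "comm_group ?W" by (intro comm_group_sum_group comm_group_cogen_group)
  have divW: "divisible_group ?W" by (intro divisible_sum_group divisible_cogen_group gU)
  have embed: "\<exists>e. e \<in> mon A ?W" if A: "comm_group A" "|carrier A| \<le>o \<kappa>" for A :: "'a monoid"
  proof -
    have "|carrier A| \<le>o |Field \<kappa>|"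
      using A(2) F\<kappa> by (meson ordIso_symmetric ordLeq_ordIso_trans)
    then obtain \<iota> where \<iota>: "inj_on \<iota> (carrier A)" "\<iota> ` carrier A \<subseteq> Field \<kappa>"
      unfolding card_of_ordLeq[symmetric] by blast
    show ?thesis
      using ex_mon_sum_group[OF A(1) comm_group_cogen_group divisible_cogen_group ex_ord_cogen_group \<iota>] .
  qed
  have W_le: "|carrier ?W| \<le>o \<kappa>"
  proof -
    have "|carrier ?W| \<le>o |Field \<kappa>|"
      by (intro card_sum_group_ordLeq inf gU card_cogen_group_ordLeq) auto
    then show ?thesis using F\<kappa> by (rule ordLeq_ordIso_trans)
  qed
  \<comment> \<open>\<open>?W\<close> plays the extension of \<open>C i\<close> via
    \<open>e\<close>; universality of the next stage sends it back by some \<open>f\<close> that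
    undoes \<open>e\<close> on \<open>C i\<close>. As \<open>?W\<close> lives in another type,
    \<open>universal_over_any_type\<close> is required.\<close>
  have extend: "\<exists>e f. e \<in> mon (C i) ?W \<and> f \<in> mon ?W G \<and> (\<forall>x\<in>carrier (C i). f (e x) = x)"
    if i: "i \<in> Field \<alpha>" for i
  proof -
    obtain e where e: "e \<in> mon (C i) ?W"
      using embed[OF C(1)[OF i]] C(2)[OF i] ordIso_imp_ordLeq by blast
    \<comment> \<open>Universality speaks of extensions of cardinality exactly
      \<open>\<kappa>\<close>; the lower bound for \<open>?W\<close> comes from the embedding
      \<open>e\<close>.\<close>
    then have "|carrier (C i)| \<le>o |carrier ?W|"
      unfolding card_of_ordLeq[symmetric] by (auto simp: mon_def hom_def)
    then have "|carrier ?W| =o \<kappa>"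
      using W_le C(2)[OF i] by (meson ordIso_iff_ordLeq ordIso_symmetric ordIso_ordLeq_trans)
    then obtain f where f: "f \<in> mon ?W (C (wo_rel.succ \<alpha> i))" "\<forall>x\<in>carrier (C i). f (e x) = x"
      using universal_over_any_type[OF univ[OF i] W _ e] by blast
    have "f \<in> mon ?W G"
      using f(1) sub[OF succ[OF i]]
      by (auto simp: mon_def hom_def ab_subgroup_def Pi_iff dest: subgroup.mem_carrier)
    with e f(2) show ?thesis by blast
  qed
  obtain i0 where i0: "i0 \<in> Field \<alpha>" using assms(4) by blast
  have G: "comm_group G" using sub[OF i0] by (simp add: ab_subgroup_def)
  have divG: "divisible_group G"
    unfolding divisible_group_def
  \<comment> \<open>An element of \<open>G\<close> appears at some stage; its image under
    \<open>e\<close> has an \<open>n\<close>-th root in \<open>?W\<close>, which \<open>f\<close>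
    carries to a root in \<open>G\<close> because \<open>f (e x) = x\<close>.\<close>
  proof (intro allI impI ballI)
    fix n :: nat and x assume n: "0 < n" and "x \<in> carrier G"
    then obtain i where i: "i \<in> Field \<alpha>" "x \<in> carrier (C i)" using un by blast
    obtain e f where ef: "e \<in> mon (C i) ?W" "f \<in> mon ?W G" "f (e x) = x"
      using extend[OF i(1)] i(2) by blast
    have ex: "e x \<in> carrier ?W" using ef(1) i(2) by (auto simp: mon_def hom_def)
    have fh: "f \<in> hom ?W G" using ef(2) by (simp add: mon_def)
    obtain y where y: "y \<in> carrier ?W" "y [^]\<^bsub>?W\<^esub> n = e x"
      using divW n ex unfolding divisible_group_def by blast
    have "f y [^]\<^bsub>G\<^esub> n = x"
      using hom_nat_pow[OF fh y(1), of n] W G y(2) ef(3) by (simp add: comm_group.axioms(2))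
    moreover have "f y \<in> carrier G" using fh y(1) by (auto simp: hom_def)
    ultimately show "\<exists>y\<in>carrier G. y [^]\<^bsub>G\<^esub> n = x" by blast
  qed
  \<comment> \<open>An ordinal below the successor cardinal of \<open>\<kappa>\<close> has at most
    \<open>\<kappa>\<close> elements, so \<open>G\<close> is a union of at most
    \<open>\<kappa>\<close> sets of size \<open>\<kappa>\<close>.\<close>
  have "|carrier G| \<le>o \<kappa>"
    unfolding un
  proof (rule card_of_UNION_ordLeq_infinite_Field[OF inf Card])
    have "|Field \<alpha>| \<le>o \<alpha>" using assms(2) by (rule card_of_least)
    then have "|Field \<alpha>| <o cardSuc \<kappa>" using assms(3) by (rule ordLeq_ordLess_trans)
    then show "|Field \<alpha>| \<le>o \<kappa>"
      by (simp add: cardSuc_ordLess_ordLeq Card)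
  qed (use C(2) ordIso_imp_ordLeq in blast)
  then obtain e where e: "e \<in> mon G ?W" using embed[OF G] by blast
  obtain f where f: "f \<in> mon ?W G" using extend[OF i0] by blast
  have "G \<cong> ?W"
    by (rule iso_sum_group_of_mutual_embedding[OF G divG comm_group_cogen_group divisible_cogen_group inf e f])
  also have "?W \<cong> sum_group (Field \<kappa>) (\<lambda>_. rat_group) \<times>\<times>
             sum_group {p. Factorial_Ring.prime p} (\<lambda>p. sum_group (Field \<kappa>) (\<lambda>_. prufer_group p))"
    by (rule sum_cogen_group_iso)
  finally show ?thesis .
qed

end
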